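(* Consider a $K$-armed stochastic bandit with mean rewards $r(1)>r(2)>\cdots>r(K)$, $a^\star=1$, and features $X\in\mathbb{R}^{K\times d}$, $d\le K$, with rows $x_1,\dots,x_K$. Assume that for any three actions $i,j,k\in[K]$ (with $j=k$ allowed) such that $r(i)>r(j)$ and $r(i)>r(k)$, one has $\langle x_i-x_j,\,x_{a^\star}-x_k\rangle>0$ if $i=a^\star$ or $j=k$, and $\langle x_i-x_j,\,x_{a^\star}-x_k\rangle\ge0$ otherwise. Let $(\theta_t)_{t\ge1}$ be generated by stochastic softmax policy gradient with linear function approximation (defined in the context) with any constant learning rate $\eta>0$. Then there exists a large enough $\tau\ge1$ such that for all $T>\tau$, $$\frac{\sum_{s=\tau}^{T}\big(r(a^\star)-\langle\pi_{\theta_s},r\rangle\big)}{T-\tau}\ \le\ \frac{2R_{\max}\left[\frac{K-1}{C}\ln\big(C\,T+e^{C}\big)+\frac{\pi^2\,(K-1)}{6\,C}\right]}{T-\tau},$$ where $C>0$ is a positive constant (and $\pi^2$ on the right-hand side is the square of the number $\pi=3.14159\ldots$).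
   Context: Bandit: actions $[K]=\{1,\dots,K\}$; each action $a$ has a reward distribution $P_a$ supported in $[-R_{\max},R_{\max}]$ ($R_{\max}>0$; given by a density with respect to a fixed finite measure on that interval) with mean $r(a)$; $r\in\mathbb{R}^K$ is the vector of mean rewards and $a^\star$ is the action with the largest mean reward. Policies: $\pi_\theta=\mathrm{softmax}(X\theta)$, i.e. $\pi_\theta(a)=\exp(\langle x_a,\theta\rangle)/\sum_{a'\in[K]}\exp(\langle x_{a'},\theta\rangle)$ for $\theta\in\mathbb{R}^d$. Stochastic softmax policy gradient: start from $\theta_1\in\mathbb{R}^d$; at each $t\ge1$, sample $a_t\sim\pi_{\theta_t}$, observe a reward $R_t(a_t)\sim P_{a_t}$, set $\hat r_t(a)=\frac{\mathbf 1\{a=a_t\}}{\pi_{\theta_t}(a)}R_t(a_t)$ for each $a\in[K]$, and update $\theta_{t+1}=\theta_t+\eta\,X^\top(\mathrm{diag}(\pi_{\theta_t})-\pi_{\theta_t}\pi_{\theta_t}^\top)\,\hat r_t$. *)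

theory Defs
  imports "HOL-Probability.Probability"
begin

text \<open>
  Actions are the naturals \<open>1, \<dots>, K\<close>; vectors indexed by actions are functions on \<open>nat\<close> of which
  only the values on \<open>{1..K}\<close> matter.  The feature matrix is given by its rows, \<open>X a\<close> being
  \<open>x\<^sub>a\<close>.
\<close>

definition reward_dist :: "real measure \<Rightarrow> (nat \<Rightarrow> real \<Rightarrow> real) \<Rightarrow> nat \<Rightarrow> real measure" where
  "reward_dist \<nu> p a = density \<nu> (\<lambda>y. ennreal (p a y))"

locale stochastic_bandit =
  fixes K :: nat and Rmax :: real and \<nu> :: "real measure"
    and p :: "nat \<Rightarrow> real \<Rightarrow> real" and r :: "nat \<Rightarrow> real"
  assumes Rmax_pos: "Rmax > 0"
    and finite_base: "finite_measure \<nu>"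
    and sets_base: "sets \<nu> = sets borel"
    and base_support: "emeasure \<nu> (UNIV - {-Rmax..Rmax}) = 0"
    and density_measurable: "\<And>a. a \<in> {1..K} \<Longrightarrow> p a \<in> borel_measurable borel"
    and density_nonneg: "\<And>a y. a \<in> {1..K} \<Longrightarrow> 0 \<le> p a y"
    and prob_space_reward: "\<And>a. a \<in> {1..K} \<Longrightarrow> prob_space (reward_dist \<nu> p a)"
    and mean_reward: "\<And>a. a \<in> {1..K} \<Longrightarrow> r a = (LINT y|reward_dist \<nu> p a. y)"

definition softmax :: "nat \<Rightarrow> (nat \<Rightarrow> real) \<Rightarrow> nat \<Rightarrow> real" where
  "softmax K z a = exp (z a) / (\<Sum>b\<in>{1..K}. exp (z b))"

definition policy :: "nat \<Rightarrow> (nat \<Rightarrow> real ^ 'd) \<Rightarrow> real ^ 'd \<Rightarrow> nat \<Rightarrow> real" where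
  "policy K X \<theta> = softmax K (\<lambda>a. X a \<bullet> \<theta>)"

definition reward_estimate :: "(nat \<Rightarrow> real) \<Rightarrow> nat \<Rightarrow> real \<Rightarrow> nat \<Rightarrow> real" where
  "reward_estimate q a\<^sub>t y a = indicator {a\<^sub>t} a / q a * y"

text \<open>The vector \<open>X\<^sup>T (diag q - q q\<^sup>T) v\<close>, with the matrix products written out as sums.\<close>

definition softmax_gradient ::
    "nat \<Rightarrow> (nat \<Rightarrow> real ^ 'd) \<Rightarrow> (nat \<Rightarrow> real) \<Rightarrow> (nat \<Rightarrow> real) \<Rightarrow> real ^ 'd" where
  "softmax_gradient K X q v =
     (\<Sum>a\<in>{1..K}. (\<Sum>b\<in>{1..K}. ((if a = b then q a else 0) - q a * q b) * v b) *\<^sub>R X a)"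

text \<open>
  The sigma-algebra generated by the actions and observed rewards of the rounds
  \<open>1, \<dots>, t - 1\<close>.
\<close>

definition history ::
    "nat \<Rightarrow> 's measure \<Rightarrow> (nat \<Rightarrow> 's \<Rightarrow> nat) \<Rightarrow> (nat \<Rightarrow> 's \<Rightarrow> real) \<Rightarrow> nat \<Rightarrow> 's measure" where
  "history K M A R t =
     vimage_algebra (space M) (\<lambda>\<omega>. \<lambda>s\<in>{1..<t}. (A s \<omega>, R s \<omega>))
       (PiM {1..<t} (\<lambda>_. count_space {1..K} \<Otimes>\<^sub>M borel))"

text \<open>
  \<open>A t\<close> is the action sampled in round \<open>t\<close> and \<open>R t\<close> the observed reward \<open>R\<^sub>t(a\<^sub>t)\<close>.  The
  assumption \<open>sampling\<close> says that, given the past, \<open>(A t, R t)\<close> is drawn by first sampling the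
  action from the current policy and then the reward from that action's distribution.
  Rounds start at 1; \<open>A 0\<close>, \<open>R 0\<close> and \<open>\<theta> 0\<close> play no role.
\<close>

locale softmax_policy_gradient =
  stochastic_bandit K Rmax \<nu> p r + prob_space M
  for K :: nat and Rmax :: real and \<nu> :: "real measure"
    and p :: "nat \<Rightarrow> real \<Rightarrow> real" and r :: "nat \<Rightarrow> real" and M :: "'s measure" +
  fixes X :: "nat \<Rightarrow> real ^ 'd" and \<eta> :: real and \<theta>\<^sub>1 :: "real ^ 'd"
    and A :: "nat \<Rightarrow> 's \<Rightarrow> nat" and R :: "nat \<Rightarrow> 's \<Rightarrow> real"
    and \<theta> :: "nat \<Rightarrow> 's \<Rightarrow> real ^ 'd"
  assumes action_measurable: "\<And>t. t \<ge> 1 \<Longrightarrow> A t \<in> measurable M (count_space {1..K})"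
    and reward_measurable: "\<And>t. t \<ge> 1 \<Longrightarrow> R t \<in> borel_measurable M"
    and init: "\<And>\<omega>. \<omega> \<in> space M \<Longrightarrow> \<theta> 1 \<omega> = \<theta>\<^sub>1"
    and update: "\<And>t \<omega>. t \<ge> 1 \<Longrightarrow> \<omega> \<in> space M \<Longrightarrow>
      \<theta> (t + 1) \<omega> = \<theta> t \<omega> + \<eta> *\<^sub>R softmax_gradient K X (policy K X (\<theta> t \<omega>))
                        (reward_estimate (policy K X (\<theta> t \<omega>)) (A t \<omega>) (R t \<omega>))"
    and sampling: "\<And>t a B. t \<ge> 1 \<Longrightarrow> a \<in> {1..K} \<Longrightarrow> B \<in> sets borel \<Longrightarrow>
      AE \<omega> in M. real_cond_exp M (history K M A R t)
                   (indicator {\<omega> \<in> space M. A t \<omega> = a \<and> R t \<omega> \<in> B}) \<omega>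
                 = policy K X (\<theta> t \<omega>) a * measure (reward_dist \<nu> p a) B"

end

theory Submission
  imports Defs
begin

text \<open>
  For \<open>k \<noteq> 1\<close> let \<open>z\<^sub>k = \<langle>x\<^sub>1 - x\<^sub>k, \<theta>\<rangle>\<close>, so that \<open>\<pi>(k) = \<pi>(1) exp (- z\<^sub>k)\<close>, and let \<open>g\<^sub>a = \<langle>x\<^sub>a, x\<^sub>1 - x\<^sub>k\<rangle>\<close>.
  The increments of \<open>z\<^sub>k\<close> have conditional mean
  \<open>\<eta> Cov\<^sub>\<pi>(r, g) = \<eta> \<Sum>\<^bsub>i < j\<^esub> \<pi>(i) \<pi>(j) (r(i) - r(j)) (g\<^sub>i - g\<^sub>j)\<close> and second moment at most
  \<open>\<eta>\<^sup>2 R\<^sub>m\<^sub>a\<^sub>x\<^sup>2 Cov\<^sub>\<pi>(g, g)\<close>.  By hypothesis the pairs with \<open>i < k\<close> contribute nonnegatively to the mean,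
  and there the second moment is dominated by the mean.  Hence an exponential supermartingale gives,
  almost surely, \<open>z\<^sub>k \<ge> \<alpha> D\<^sub>k - \<beta> E\<^sub>k - B\<close>, where \<open>D\<^sub>k\<close> is the accumulated contribution of these pairs,
  \<open>E\<^sub>k\<close> the accumulated mass of the others, and only \<open>B\<close> depends on the sample path.

  Descending from \<open>k = K\<close>, one gets \<open>\<Sum>\<^sub>t \<pi>\<^sub>t(i) \<pi>\<^sub>t(k) < \<infinity>\<close> for all \<open>i \<notin> {1, k}\<close>: if this holds for all
  larger \<open>k\<close>, then \<open>E\<^sub>k\<close> is bounded, and \<open>\<pi>(i) \<pi>(k) = \<pi>(i) \<pi>(1) exp (- z\<^sub>k)\<close> is at most a constant times
  \<open>D\<^sub>k' exp (- \<alpha> D\<^sub>k)\<close>, with \<open>D\<^sub>k'\<close> the increment of \<open>D\<^sub>k\<close>.  So \<open>z\<^sub>k \<ge> \<kappa> G - B'\<close> for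
  \<open>G = \<Sum>\<^sub>t \<pi>\<^sub>t(1) (1 - \<pi>\<^sub>t(1))\<close>.  If \<open>G\<close> stayed bounded, all pair masses would be summable, all \<open>z\<^sub>k\<close>
  bounded, and the pair masses bounded away from 0, which is absurd.  So \<open>G \<rightarrow> \<infinity>\<close> and \<open>\<pi>\<^sub>t(1) \<rightarrow> 1\<close>; moreover
  the increment of \<open>G\<close> is \<open>O(exp (- \<kappa> G))\<close>, so \<open>G\<close> grows at most like \<open>ln t / \<kappa>\<close> with a
  deterministic \<open>\<kappa>\<close>, and eventually \<open>4 R\<^sub>m\<^sub>a\<^sub>x\<close> times the increment of \<open>G\<close> bounds the suboptimality.
\<close>

section \<open>Weighted covariances and pair masses\<close>

text \<open>For weights of total mass 1 this is the covariance of \<open>f\<close> and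
  \<open>g\<close> under \<open>q\<close>. Only \<open>g\<close> is centred, which is the form in
  which the conditional mean of a gradient step arises.\<close>

definition weighted_cov :: "nat \<Rightarrow> (nat \<Rightarrow> real) \<Rightarrow> (nat \<Rightarrow> real) \<Rightarrow> (nat \<Rightarrow> real) \<Rightarrow> real" where
  "weighted_cov K q f g = (\<Sum>a\<in>{1..K}. q a * (f a * (g a - (\<Sum>b\<in>{1..K}. q b * g b))))"

text \<open>Both sides reduce to \<open>H - F * G\<close>, the mean of the product minus the product
  of the means. The symmetric form exposes the sign of each pair's contribution; the division by 2
  is due to counting ordered pairs.\<close>

lemma weighted_cov_pairs:
  assumes "(\<Sum>a\<in>{1..K}. q a) = 1"
  shows "weighted_cov K q f g =
    (\<Sum>i\<in>{1..K}. \<Sum>j\<in>{1..K}. q i * q j * ((f i - f j) * (g i - g j))) / 2"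
proof -
  let ?I = "{1..K}"
  define F where "F = (\<Sum>i\<in>?I. q i * f i)"
  define G where "G = (\<Sum>i\<in>?I. q i * g i)"
  define H where "H = (\<Sum>i\<in>?I. q i * (f i * g i))"
  have "(\<Sum>i\<in>?I. \<Sum>j\<in>?I. q i * q j * ((f i - f j) * (g i - g j)))
     = (\<Sum>i\<in>?I. \<Sum>j\<in>?I. q i * (f i * g i) * q j - q i * f i * (q j * g j)
          - q i * g i * (q j * f j) + q i * (q j * (f j * g j)))"
    by (intro sum.cong refl) (simp add: algebra_simps)
  also have "\<dots> = H * 1 - F * G - G * F + 1 * H"
    unfolding F_def G_def H_def assms[symmetric]
    by (simp add: sum.distrib sum_subtractf sum_product)
  finally have *: "(\<Sum>i\<in>?I. \<Sum>j\<in>?I. q i * q j * ((f i - f j) * (g i - g j))) = 2 * (H - F * G)"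
    by simp
  have "weighted_cov K q f g = (\<Sum>a\<in>?I. q a * (f a * g a) - q a * f a * G)"
    unfolding weighted_cov_def G_def by (intro sum.cong refl) (simp add: algebra_simps)
  also have "\<dots> = H - F * G"
    unfolding H_def F_def by (simp add: sum_subtractf sum_distrib_right)
  finally show ?thesis using * by simp
qed

lemma weighted_cov_self:
  assumes "(\<Sum>a\<in>{1..K}. q a) = 1"
  shows "(\<Sum>a\<in>{1..K}. q a * (g a - (\<Sum>b\<in>{1..K}. q b * g b))\<^sup>2) = weighted_cov K q g g"
proof -
  define G where "G = (\<Sum>b\<in>{1..K}. q b * g b)"
  have "(\<Sum>a\<in>{1..K}. q a * (g a - G)\<^sup>2) - weighted_cov K q g g
     = (\<Sum>a\<in>{1..K}. G * (G * q a - q a * g a))"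
    unfolding weighted_cov_def G_def[symmetric] sum_subtractf[symmetric]
    by (intro sum.cong refl) (simp add: algebra_simps power2_eq_square)
  also have "\<dots> = G * (G * (\<Sum>a\<in>{1..K}. q a) - G)"
    unfolding sum_distrib_left[symmetric] sum_subtractf by (simp add: G_def)
  finally show ?thesis using assms by (simp add: G_def)
qed

text \<open>For a probability vector \<open>q\<close> and \<open>c\<close> constantly 1 this is the
  probability that two independent draws from \<open>q\<close> satisfy \<open>P\<close>. Pairs are
  ordered, and the diagonal counts whenever \<open>P i i\<close> holds.\<close>

definition pair_mass :: "nat \<Rightarrow> (nat \<Rightarrow> nat \<Rightarrow> bool) \<Rightarrow> (nat \<Rightarrow> nat \<Rightarrow> real) \<Rightarrow> (nat \<Rightarrow> real) \<Rightarrow> real" where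
  "pair_mass K P c q = (\<Sum>i\<in>{1..K}. \<Sum>j\<in>{1..K}. if P i j then q i * q j * c i j else 0)"

lemma pair_mass_mono:
  assumes "\<And>i. i \<in> {1..K} \<Longrightarrow> q i \<ge> 0"
    and "\<And>i j. i \<in> {1..K} \<Longrightarrow> j \<in> {1..K} \<Longrightarrow> (if P i j then c i j else 0) \<le> (if Q i j then d i j else 0)"
  shows "pair_mass K P c q \<le> pair_mass K Q d q"
  unfolding pair_mass_def
proof (intro sum_mono)
  fix i j assume ij: "i \<in> {1..K}" "j \<in> {1..K}"
  have "(q i * q j) * (if P i j then c i j else 0) \<le> (q i * q j) * (if Q i j then d i j else 0)"
    using assms ij by (intro mult_left_mono) auto
  then show "(if P i j then q i * q j * c i j else 0) \<le> (if Q i j then q i * q j * d i j else 0)"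
    by (auto split: if_splits)
qed

lemma pair_mass_nonneg:
  assumes "\<And>i. i \<in> {1..K} \<Longrightarrow> q i \<ge> 0"
    and "\<And>i j. i \<in> {1..K} \<Longrightarrow> j \<in> {1..K} \<Longrightarrow> P i j \<Longrightarrow> 0 \<le> c i j"
  shows "0 \<le> pair_mass K P c q"
  unfolding pair_mass_def using assms by (auto intro!: sum_nonneg mult_nonneg_nonneg)

lemma pair_mass_cmult: "pair_mass K P (\<lambda>i j. b * c i j) q = b * pair_mass K P c q"
  unfolding pair_mass_def sum_distrib_left by (auto intro!: sum.cong)

lemma pair_mass_le:
  assumes q: "\<And>i. i \<in> {1..K} \<Longrightarrow> q i \<ge> 0" "(\<Sum>i\<in>{1..K}. q i) = 1" and "0 \<le> b"
    and c: "\<And>i j. i \<in> {1..K} \<Longrightarrow> j \<in> {1..K} \<Longrightarrow> P i j \<Longrightarrow> c i j \<le> b"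
  shows "pair_mass K P c q \<le> b"
proof -
  have "pair_mass K P c q \<le> pair_mass K (\<lambda>_ _. True) (\<lambda>_ _. b) q"
    using assms by (intro pair_mass_mono) auto
  also have "\<dots> = (\<Sum>i\<in>{1..K}. q i) * (\<Sum>j\<in>{1..K}. q j) * b"
    unfolding pair_mass_def sum_product by (simp only: sum_distrib_right if_True)
  finally show ?thesis using q by simp
qed

text \<open>Diagonal terms of the double sum vanish, so the complement of \<open>P\<close> can be
  taken off the diagonal.\<close>

lemma weighted_cov_split:
  assumes "(\<Sum>a\<in>{1..K}. q a) = 1"
  shows "2 * weighted_cov K q f g =
    pair_mass K P (\<lambda>i j. (f i - f j) * (g i - g j)) q +
    pair_mass K (\<lambda>i j. i \<noteq> j \<and> \<not> P i j) (\<lambda>i j. (f i - f j) * (g i - g j)) q"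
  unfolding weighted_cov_pairs[OF assms] pair_mass_def sum.distrib[symmetric]
  by (auto intro!: sum.cong)

lemma summable_pair_mass:
  assumes "\<And>i j. i \<in> {1..K} \<Longrightarrow> j \<in> {1..K} \<Longrightarrow> P i j \<Longrightarrow> summable (\<lambda>n. q n i * q n j :: real)"
  shows "summable (\<lambda>n. pair_mass K P c (q n))"
  unfolding pair_mass_def
proof (intro summable_sum)
  fix i j assume "i \<in> {1..K}" "j \<in> {1..K}"
  with assms[of i j] show "summable (\<lambda>n. if P i j then q n i * q n j * c i j else 0)"
    by (cases "P i j") (auto intro: summable_mult2)
qed

lemma weighted_cov_scale_right: "weighted_cov K q f (\<lambda>a. l * g a) = l * weighted_cov K q f g"
proof -
  define G where "G = (\<Sum>b\<in>{1..K}. q b * g b)"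
  have "(\<Sum>b\<in>{1..K}. q b * (l * g b)) = l * G"
    unfolding G_def sum_distrib_left by (intro sum.cong refl) simp
  then show ?thesis
    unfolding weighted_cov_def G_def[symmetric] sum_distrib_left
    by (intro sum.cong refl) (simp add: algebra_simps)
qed

lemma weighted_cov_scale_left: "weighted_cov K q (\<lambda>a. l * f a) g = l * weighted_cov K q f g"
  unfolding weighted_cov_def sum_distrib_left by (intro sum.cong refl) simp

text \<open>In \<open>d\<close> are the pairs with at least one arm below \<open>k\<close>; there
  \<open>dom\<close> charges the second moment to the drift. Pairs within \<open>{k..K}\<close> have
  no known sign, so each is bounded by \<open>L\<^sup>2\<close>.\<close>

lemma weighted_cov_drift_bounds:
  fixes f g q :: "nat \<Rightarrow> real" and k K :: nat
  defines "P \<equiv> \<lambda>i j. \<not> (k \<le> i \<and> k \<le> j)"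
  defines "d \<equiv> pair_mass K P (\<lambda>i j. (f i - f j) * (g i - g j)) q"
    and "e \<equiv> pair_mass K (\<lambda>i j. i \<noteq> j \<and> k \<le> i \<and> k \<le> j) (\<lambda>_ _. 1) q"
  assumes q: "\<And>i. i \<in> {1..K} \<Longrightarrow> q i \<ge> 0" "(\<Sum>i\<in>{1..K}. q i) = 1"
    and f: "\<And>i j. i \<in> {1..K} \<Longrightarrow> j \<in> {1..K} \<Longrightarrow> \<bar>f i - f j\<bar> \<le> L"
    and g: "\<And>i j. i \<in> {1..K} \<Longrightarrow> j \<in> {1..K} \<Longrightarrow> \<bar>g i - g j\<bar> \<le> L"
    and dom: "\<And>i j. i \<in> {1..K} \<Longrightarrow> j \<in> {1..K} \<Longrightarrow> P i j \<Longrightarrow>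
        (g i - g j) * (g i - g j) \<le> L * ((f i - f j) * (g i - g j))"
  shows "2 * weighted_cov K q f g \<ge> d - L\<^sup>2 * e"
    and "2 * weighted_cov K q f g \<le> d + L\<^sup>2 * e"
    and "2 * weighted_cov K q g g \<le> L * d + L\<^sup>2 * e"
    and "d \<le> L\<^sup>2 * pair_mass K (\<noteq>) (\<lambda>_ _. 1) q"
proof -
  have fg: "\<bar>(f i - f j) * (g i - g j)\<bar> \<le> L\<^sup>2" "(g i - g j) * (g i - g j) \<le> L\<^sup>2"
    if "i \<in> {1..K}" "j \<in> {1..K}" for i j
  proof -
    have *: "0 \<le> L" using f[OF that] by linarith
    show "\<bar>(f i - f j) * (g i - g j)\<bar> \<le> L\<^sup>2"
      unfolding abs_mult power2_eq_square using f[OF that] g[OF that] * by (intro mult_mono) auto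
    have "\<bar>(g i - g j) * (g i - g j)\<bar> \<le> L\<^sup>2"
      unfolding abs_mult power2_eq_square using g[OF that] * by (intro mult_mono) auto
    then show "(g i - g j) * (g i - g j) \<le> L\<^sup>2" by simp
  qed
  have nP: "(\<lambda>i j. i \<noteq> j \<and> \<not> P i j) = (\<lambda>i j. i \<noteq> j \<and> k \<le> i \<and> k \<le> j)"
    by (simp add: P_def)
  note split = weighted_cov_split[OF q(2), where P = P, unfolded nP]
  let ?Q = "\<lambda>i j. i \<noteq> j \<and> k \<le> i \<and> k \<le> j"
  have "pair_mass K ?Q (\<lambda>_ _. - L\<^sup>2 * 1) q \<le> pair_mass K ?Q (\<lambda>i j. (f i - f j) * (g i - g j)) q"
    using fg(1) by (intro pair_mass_mono q) (auto simp: abs_le_iff minus_le_iff)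
  then show "2 * weighted_cov K q f g \<ge> d - L\<^sup>2 * e"
    unfolding split pair_mass_cmult d_def e_def by simp
  have "pair_mass K ?Q (\<lambda>i j. (f i - f j) * (g i - g j)) q \<le> pair_mass K ?Q (\<lambda>_ _. L\<^sup>2 * 1) q"
    using fg(1) by (intro pair_mass_mono q) (auto simp: abs_le_iff)
  then show "2 * weighted_cov K q f g \<le> d + L\<^sup>2 * e"
    unfolding split pair_mass_cmult d_def e_def by simp
  have "pair_mass K ?Q (\<lambda>i j. (g i - g j) * (g i - g j)) q \<le> pair_mass K ?Q (\<lambda>_ _. L\<^sup>2 * 1) q"
    using fg(2) by (intro pair_mass_mono q) auto
  moreover have "pair_mass K P (\<lambda>i j. (g i - g j) * (g i - g j)) q
      \<le> pair_mass K P (\<lambda>i j. L * ((f i - f j) * (g i - g j))) q"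
    using dom by (intro pair_mass_mono q) auto
  ultimately show "2 * weighted_cov K q g g \<le> L * d + L\<^sup>2 * e"
    unfolding split pair_mass_cmult d_def e_def by simp
  have "d \<le> pair_mass K (\<noteq>) (\<lambda>_ _. L\<^sup>2 * 1) q"
    unfolding d_def using fg(1) by (intro pair_mass_mono q) (auto simp: abs_le_iff)
  then show "d \<le> L\<^sup>2 * pair_mass K (\<noteq>) (\<lambda>_ _. 1) q"
    unfolding pair_mass_cmult .
qed

lemma pair_mass_first:
  assumes "(\<Sum>i\<in>{1..K}. q i) = 1" "K \<ge> 1"
  shows "pair_mass K (\<lambda>i j. i = 1 \<and> j \<noteq> 1) (\<lambda>_ _. 1) q = q 1 * (1 - q 1)"
proof -
  have split: "{1..K} = insert 1 {2..K}" using assms(2) by auto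
  have "pair_mass K (\<lambda>i j. i = 1 \<and> j \<noteq> 1) (\<lambda>_ _. 1) q = (\<Sum>j\<in>{2..K}. q 1 * q j)"
    unfolding pair_mass_def split by simp
  also have "\<dots> = q 1 * (\<Sum>j\<in>{2..K}. q j)" by (simp add: sum_distrib_left)
  also have "(\<Sum>j\<in>{2..K}. q j) = 1 - q 1" using assms(1) unfolding split by simp
  finally show ?thesis .
qed

section \<open>Growth of the log-odds along a sample path\<close>

text \<open>A discrete version of integrating \<open>exp (- \<alpha> * D)\<close> with respect to
  \<open>D\<close>: each term is compared with a decrement of that exponential, and the decrements
  telescope. The factor \<open>exp (\<alpha> * b)\<close> pays for evaluating at the left end of a
  jump of size at most \<open>b\<close>.\<close>

lemma sum_damped_le:
  fixes d :: "nat \<Rightarrow> real"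
  assumes "\<And>n. d n \<ge> 0" "\<And>n. d n \<le> b" "\<alpha> > 0"
  shows "(\<Sum>s<n. d s * exp (- \<alpha> * (\<Sum>i<s. d i))) \<le> exp (\<alpha> * b) / \<alpha> * (1 - exp (- \<alpha> * (\<Sum>i<n. d i)))"
proof (induction n)
  case 0
  show ?case by simp
next
  case (Suc n)
  define D where "D = (\<Sum>i<n. d i)"
  \<comment> \<open>With \<open>x = \<alpha> * d n\<close> the right-hand side is
    \<open>exp x - 1\<close>.\<close>
  have "\<alpha> * d n \<le> exp (\<alpha> * d n) * (1 - exp (- \<alpha> * d n))"
    using exp_ge_add_one_self[of "\<alpha> * d n"] by (simp add: exp_minus algebra_simps)
  also have "\<dots> \<le> exp (\<alpha> * b) * (1 - exp (- \<alpha> * d n))"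
    using assms by (intro mult_right_mono) auto
  finally have "d n \<le> exp (\<alpha> * b) / \<alpha> * (1 - exp (- \<alpha> * d n))"
    using assms(3) by (simp add: field_simps)
  then have "d n * exp (- \<alpha> * D) \<le> exp (\<alpha> * b) / \<alpha> * (1 - exp (- \<alpha> * d n)) * exp (- \<alpha> * D)"
    by (intro mult_right_mono) auto
  also have "\<dots> = exp (\<alpha> * b) / \<alpha> * (exp (- \<alpha> * D) - exp (- \<alpha> * (D + d n)))"
    by (simp add: algebra_simps exp_add[symmetric])
  finally show ?case
    using Suc by (simp add: D_def algebra_simps)
qed

lemma summable_damped:
  fixes d :: "nat \<Rightarrow> real"
  assumes "\<And>n. d n \<ge> 0" "\<And>n. d n \<le> b" "\<alpha> > 0"
  shows "summable (\<lambda>n. d n * exp (- \<alpha> * (\<Sum>i<n. d i)))"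
proof (rule bounded_imp_summable)
  fix n
  show "0 \<le> d n * exp (- \<alpha> * (\<Sum>i<n. d i))" using assms by simp
  have "(\<Sum>s<Suc n. d s * exp (- \<alpha> * (\<Sum>i<s. d i))) \<le> exp (\<alpha> * b) / \<alpha> * (1 - exp (- \<alpha> * (\<Sum>i<Suc n. d i)))"
    by (rule sum_damped_le[OF assms])
  also have "\<dots> \<le> exp (\<alpha> * b) / \<alpha> * 1"
    using assms(3) by (intro mult_left_mono) auto
  finally show "(\<Sum>s\<le>n. d s * exp (- \<alpha> * (\<Sum>i<s. d i))) \<le> exp (\<alpha> * b) / \<alpha>"
    by (simp add: lessThan_Suc_atMost)
qed

text \<open>Discrete comparison with the equation G' = c exp(-\<kappa> G), along which exp(\<kappa>
  G) grows linearly. Jumps have size at most 1, and the discretisation costs the factor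
  \<open>exp \<kappa>\<close>.\<close>

lemma exp_sum_le_linear:
  fixes x :: "nat \<Rightarrow> real"
  assumes x: "\<And>n. 0 \<le> x n" "\<And>n. x n \<le> 1" and \<kappa>: "\<kappa> > 0"
    and le: "\<And>n. x n \<le> c * exp (- \<kappa> * (\<Sum>s<n. x s))"
  shows "exp (\<kappa> * (\<Sum>s<n. x s)) \<le> 1 + \<kappa> * exp \<kappa> * c * real n"
proof (induction n)
  case 0
  show ?case by simp
next
  case (Suc n)
  define G where "G = (\<Sum>s<n. x s)"
  have "exp (- (\<kappa> * x n)) \<ge> 1 - \<kappa> * x n"
    using exp_ge_add_one_self[of "- (\<kappa> * x n)"] by simp
  then have "exp (\<kappa> * x n) * (1 - \<kappa> * x n) \<le> exp (\<kappa> * x n) * exp (- (\<kappa> * x n))"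
    by (intro mult_left_mono) auto
  then have "exp (\<kappa> * x n) \<le> 1 + exp (\<kappa> * x n) * (\<kappa> * x n)"
    by (simp add: exp_minus algebra_simps)
  also have "\<dots> \<le> 1 + exp \<kappa> * (\<kappa> * x n)"
    using x[of n] \<kappa> by (intro add_left_mono mult_right_mono) (auto simp: mult_left_le)
  finally have "exp (\<kappa> * G) * exp (\<kappa> * x n) \<le> exp (\<kappa> * G) * (1 + exp \<kappa> * (\<kappa> * x n))"
    by (intro mult_left_mono) auto
  also have "\<dots> = exp (\<kappa> * G) + \<kappa> * exp \<kappa> * (exp (\<kappa> * G) * x n)"
    by (simp add: algebra_simps)
  also have "\<dots> \<le> exp (\<kappa> * G) + \<kappa> * exp \<kappa> * c"
  proof -
    have "exp (\<kappa> * G) * x n \<le> exp (\<kappa> * G) * (c * exp (- \<kappa> * G))"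
      using le[of n] by (intro mult_left_mono) (auto simp: G_def)
    also have "\<dots> = c" by (simp add: exp_minus)
    finally show ?thesis using \<kappa> by (intro add_left_mono mult_left_mono) auto
  qed
  finally have "exp (\<kappa> * (G + x n)) \<le> exp (\<kappa> * G) + \<kappa> * exp \<kappa> * c"
    by (simp add: exp_add algebra_simps)
  with Suc show ?case by (simp add: G_def algebra_simps)
qed

text \<open>
  \<open>d k n\<close> is the part of the drift of the log-odds \<open>z k n\<close> of arm 1 against arm \<open>k\<close> that comes from
  the pairs of arms containing one better than \<open>k\<close>.  The remaining pairs have no definite sign;
  descending on \<open>k\<close>, their total mass is already known to be summable.
\<close>

locale log_odds =
  fixes K :: nat and q :: "nat \<Rightarrow> nat \<Rightarrow> real" and z d :: "nat \<Rightarrow> nat \<Rightarrow> real"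
    and c b \<alpha> \<beta> :: real
  assumes K2: "K \<ge> 2"
    and q_pos: "\<And>n i. i \<in> {1..K} \<Longrightarrow> q n i > 0"
    and q_sum: "\<And>n. (\<Sum>i\<in>{1..K}. q n i) = 1"
    and q_odds: "\<And>n k. k \<in> {2..K} \<Longrightarrow> q n k = q n 1 * exp (- z k n)"
    and c_pos: "c > 0" and \<alpha>_pos: "\<alpha> > 0" and \<beta>_nonneg: "\<beta> \<ge> 0"
    and d_lower: "\<And>n k. k \<in> {2..K} \<Longrightarrow> c * (q n 1 * (1 - q n 1)) \<le> d k n"
    and d_upper: "\<And>n k. k \<in> {2..K} \<Longrightarrow> d k n \<le> b * pair_mass K (\<noteq>) (\<lambda>_ _. 1) (q n)"
    and z_lower: "\<And>k. k \<in> {2..K} \<Longrightarrow> \<exists>B. \<forall>n. z k n \<ge> \<alpha> * (\<Sum>s<n. d k s)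
         - \<beta> * (\<Sum>s<n. pair_mass K (\<lambda>i j. i \<noteq> j \<and> k \<le> i \<and> k \<le> j) (\<lambda>_ _. 1) (q s)) - B"
    and z_upper: "\<And>k. k \<in> {2..K} \<Longrightarrow> \<exists>B. \<forall>n. z k n \<le> \<beta> * (\<Sum>s<n. d k s)
         + \<beta> * (\<Sum>s<n. pair_mass K (\<lambda>i j. i \<noteq> j \<and> k \<le> i \<and> k \<le> j) (\<lambda>_ _. 1) (q s)) + B"
begin

lemma q_le_1: "i \<in> {1..K} \<Longrightarrow> q n i \<le> 1"
  using member_le_sum[of i "{1..K}" "q n"] q_pos[of _ n] q_sum[of n] by (auto simp: less_imp_le)

lemma one_in: "1 \<in> {1..K}"
  using K2 by simp

lemma q_pair_le: "i \<in> {2..K} \<Longrightarrow> q n i \<le> 1 - q n 1"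
proof -
  assume i: "i \<in> {2..K}"
  have "q n i + q n 1 = (\<Sum>j\<in>{i, 1}. q n j)" using i by simp
  also have "\<dots> \<le> (\<Sum>j\<in>{1..K}. q n j)"
    using i q_pos[of _ n] by (intro sum_mono2) (auto simp: less_imp_le)
  finally show ?thesis using q_sum[of n] by simp
qed

lemma d_nonneg: "k \<in> {2..K} \<Longrightarrow> 0 \<le> d k n"
proof -
  assume k: "k \<in> {2..K}"
  have "0 \<le> c * (q n 1 * (1 - q n 1))"
    using c_pos q_pos[OF one_in, of n] q_le_1[OF one_in, of n] by simp
  then show ?thesis using d_lower[OF k, of n] by linarith
qed

lemma pair_mass_bounds:
  "0 \<le> pair_mass K P (\<lambda>_ _. 1) (q n)" "pair_mass K P (\<lambda>_ _. 1) (q n) \<le> 1"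
  using q_pos[of _ n] q_sum[of n]
  by (auto intro!: pair_mass_nonneg pair_mass_le simp: less_imp_le)

lemma d_bounded: "k \<in> {2..K} \<Longrightarrow> d k n \<le> \<bar>b\<bar>"
proof -
  assume k: "k \<in> {2..K}"
  have "b * pair_mass K (\<noteq>) (\<lambda>_ _. 1) (q n) \<le> \<bar>b\<bar> * 1"
    by (intro mult_mono pair_mass_bounds) auto
  then show ?thesis using d_upper[OF k, of n] by linarith
qed

text \<open>Once the mass of the pairs without a definite sign is summable, its contribution is
  absorbed into the path-dependent constant.\<close>

lemma z_lower_summable:
  assumes k: "k \<in> {2..K}"
    and "summable (\<lambda>n. pair_mass K (\<lambda>i j. i \<noteq> j \<and> k \<le> i \<and> k \<le> j) (\<lambda>_ _. 1) (q n))"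
  shows "\<exists>B. \<forall>n. z k n \<ge> \<alpha> * (\<Sum>s<n. d k s) - B"
proof -
  let ?e = "\<lambda>n. pair_mass K (\<lambda>i j. i \<noteq> j \<and> k \<le> i \<and> k \<le> j) (\<lambda>_ _. 1) (q n)"
  obtain B where B: "\<And>n. z k n \<ge> \<alpha> * (\<Sum>s<n. d k s) - \<beta> * (\<Sum>s<n. ?e s) - B"
    using z_lower[OF k] by blast
  have "z k n \<ge> \<alpha> * (\<Sum>s<n. d k s) - (\<beta> * suminf ?e + B)" for n
  proof -
    have "\<beta> * (\<Sum>s<n. ?e s) \<le> \<beta> * suminf ?e"
      by (intro mult_left_mono sum_le_suminf assms(2) \<beta>_nonneg pair_mass_bounds) simp
    then show ?thesis using B[of n] by linarith
  qed
  then show ?thesis by blast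
qed

lemma summable_pair:
  assumes "k \<in> {2..K}" "i \<in> {2..K}" "i \<noteq> k"
  shows "summable (\<lambda>n. q n i * q n k)"
  using assms
\<comment> \<open>The induction descends from the last arm; for \<open>k = K\<close> no pair is left
  in the error mass \<open>e\<close>.\<close>
proof (induction "K - k" arbitrary: i k rule: less_induct)
  case less
  have e: "summable (\<lambda>n. pair_mass K (\<lambda>i j. i \<noteq> j \<and> k \<le> i \<and> k \<le> j) (\<lambda>_ _. 1) (q n))"
  proof (rule summable_pair_mass)
    fix i j assume ij: "i \<in> {1..K}" "j \<in> {1..K}" "i \<noteq> j \<and> k \<le> i \<and> k \<le> j"
    show "summable (\<lambda>n. q n i * q n j)"
    \<comment> \<open>One of the two distinct indices exceeds \<open>k\<close> and takes the role of
      \<open>k\<close> in the induction hypothesis. In the second case \<open>j = k\<close>, so it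
      is \<open>i\<close>, and the product is commuted.\<close>
    proof (cases "j > k")
      case True
      then show ?thesis using ij less(2) by (intro less(1)) auto
    next
      case False
      then have "summable (\<lambda>n. q n j * q n i)" using ij less(2) by (intro less(1)) auto
      then show ?thesis by (simp add: mult.commute)
    qed
  qed
  obtain B where B: "\<And>n. z k n \<ge> \<alpha> * (\<Sum>s<n. d k s) - B"
    using z_lower_summable[OF less(2) e] by blast
  let ?f = "\<lambda>n. d k n * exp (- \<alpha> * (\<Sum>s<n. d k s))"
  have "summable (\<lambda>n. exp B / c * ?f n)"
    using summable_damped[of "d k" "\<bar>b\<bar>" \<alpha>] d_nonneg d_bounded \<alpha>_pos less(2)
    by (intro summable_mult) auto
  moreover have "norm (q n i * q n k) \<le> exp B / c * ?f n" for n
  proof -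
    \<comment> \<open>Since \<open>i\<close> is not arm 1, its mass is part of
      \<open>1 - q n 1\<close>, so \<open>d_lower\<close> turns this product into drift of arm
      \<open>k\<close>. The remaining odds factor \<open>exp (- z k n)\<close> supplies the
      damping.\<close>
    have "q n i * q n 1 \<le> (1 - q n 1) * q n 1"
      using q_pair_le[of i n] q_pos[OF one_in, of n] less by (intro mult_right_mono) auto
    also have "\<dots> \<le> d k n / c"
      using d_lower[OF less(2), of n] c_pos by (simp add: field_simps)
    finally have 1: "q n i * q n 1 \<le> d k n / c" .
    have "q n i * q n k = (q n i * q n 1) * exp (- z k n)"
      using q_odds[OF less(2), of n] by simp
    also have "\<dots> \<le> (d k n / c) * exp (B - \<alpha> * (\<Sum>s<n. d k s))"
      using 1 B[of n] d_nonneg[OF less(2), of n] c_pos by (intro mult_mono) auto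
    also have "\<dots> = exp B / c * ?f n" by (simp add: exp_diff exp_minus field_simps)
    finally show ?thesis using q_pos[of i n] q_pos[of k n] less by simp
  qed
  ultimately show ?case by (rule summable_comparison_test'[where N = 0])
qed

text \<open>The error mass of arm \<open>k\<close> involves only distinct arms from
  \<open>{2..K}\<close>, all covered by \<open>summable_pair\<close>. The drift is then replaced by
  its lower bound, which is the same for every \<open>k\<close>.\<close>

lemma z_lower':
  assumes k: "k \<in> {2..K}"
  shows "\<exists>B. \<forall>n. z k n \<ge> \<alpha> * c * (\<Sum>s<n. q s 1 * (1 - q s 1)) - B"
proof -
  have "summable (\<lambda>n. pair_mass K (\<lambda>i j. i \<noteq> j \<and> k \<le> i \<and> k \<le> j) (\<lambda>_ _. 1) (q n))"
    using k by (intro summable_pair_mass) (auto intro!: summable_pair)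
  from z_lower_summable[OF k this] obtain B where
    B: "\<And>n. z k n \<ge> \<alpha> * (\<Sum>s<n. d k s) - B" by blast
  have "\<alpha> * c * (\<Sum>s<n. q s 1 * (1 - q s 1)) \<le> \<alpha> * (\<Sum>s<n. d k s)" for n
    using d_lower[OF k] \<alpha>_pos by (auto simp: sum_distrib_left mult.assoc intro!: sum_mono mult_left_mono)
  then show ?thesis using B by (smt (verit))
qed

lemma z_lower_uniform:
  obtains B where "\<And>k n. k \<in> {2..K} \<Longrightarrow> z k n \<ge> \<alpha> * c * (\<Sum>s<n. q s 1 * (1 - q s 1)) - B"
proof -
  obtain B where B: "\<And>k n. k \<in> {2..K} \<Longrightarrow> z k n \<ge> \<alpha> * c * (\<Sum>s<n. q s 1 * (1 - q s 1)) - B k"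
    using z_lower' by metis
  have "B k \<le> (\<Sum>k\<in>{2..K}. \<bar>B k\<bar>)" if "k \<in> {2..K}" for k
    using member_le_sum[of k "{2..K}" "\<lambda>k. \<bar>B k\<bar>"] that by auto
  then have "z k n \<ge> \<alpha> * c * (\<Sum>s<n. q s 1 * (1 - q s 1)) - (\<Sum>k\<in>{2..K}. \<bar>B k\<bar>)" if "k \<in> {2..K}" for k n
    using B[OF that, of n] that by (smt (verit))
  then show ?thesis by (rule that)
qed

lemma one_minus_q: "1 - q n 1 = q n 1 * (\<Sum>k\<in>{2..K}. exp (- z k n))"
proof -
  have "{1..K} = insert 1 {2..K}" using K2 by auto
  then have "q n 1 + (\<Sum>k\<in>{2..K}. q n k) = 1" using q_sum[of n] by simp
  then have "1 - q n 1 = (\<Sum>k\<in>{2..K}. q n k)" by simp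
  also have "\<dots> = q n 1 * (\<Sum>k\<in>{2..K}. exp (- z k n))"
    unfolding sum_distrib_left using q_odds by (intro sum.cong) auto
  finally show ?thesis .
qed

lemma not_summable: "\<not> summable (\<lambda>n. q n 1 * (1 - q n 1))"
proof
  assume S: "summable (\<lambda>n. q n 1 * (1 - q n 1))"
  have S1: "summable (\<lambda>n. q n 1 * q n j)" if "j \<in> {2..K}" for j
  proof (rule summable_comparison_test'[OF S, where N = 0])
    fix n show "norm (q n 1 * q n j) \<le> q n 1 * (1 - q n 1)"
      using q_pair_le[OF that, of n] q_pos[OF one_in, of n] q_pos[of j n] that
      by (auto intro!: mult_left_mono)
  qed
  have V: "summable (\<lambda>n. pair_mass K P (\<lambda>_ _. 1) (q n))"
    if "\<And>i j. P i j \<Longrightarrow> i \<noteq> j" for P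
  proof (rule summable_pair_mass)
    fix i j assume ij: "i \<in> {1..K}" "j \<in> {1..K}" "P i j"
    then have "i \<noteq> j" using that by blast
    then consider "i = 1" "j \<in> {2..K}" | "j = 1" "i \<in> {2..K}" | "j \<in> {2..K}" "i \<in> {2..K}"
      using ij by fastforce
    then show "summable (\<lambda>n. q n i * q n j)"
      using S1[of i] S1[of j] summable_pair[of j i] \<open>i \<noteq> j\<close> by cases (auto simp: mult.commute)
  qed
  have V': "summable (\<lambda>n. pair_mass K (\<noteq>) (\<lambda>_ _. 1) (q n))" by (rule V) auto
  have "\<exists>B. \<forall>n. z k n \<le> B" if k: "k \<in> {2..K}" for k
  proof -
    let ?e = "\<lambda>n. pair_mass K (\<lambda>i j. i \<noteq> j \<and> k \<le> i \<and> k \<le> j) (\<lambda>_ _. 1) (q n)"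
    have e: "summable ?e" by (rule V) auto
    have d: "summable (d k)"
      using d_upper[OF k] d_nonneg[OF k] by (intro summable_comparison_test'[OF summable_mult[OF V'], where N = 0]) auto
    obtain B where B: "\<And>n. z k n \<le> \<beta> * (\<Sum>s<n. d k s) + \<beta> * (\<Sum>s<n. ?e s) + B"
      using z_upper[OF k] by blast
    have "z k n \<le> \<beta> * suminf (d k) + \<beta> * suminf ?e + B" for n
    proof -
      have "\<beta> * (\<Sum>s<n. d k s) \<le> \<beta> * suminf (d k)" "\<beta> * (\<Sum>s<n. ?e s) \<le> \<beta> * suminf ?e"
        using \<beta>_nonneg d e d_nonneg[OF k]
        by (auto intro!: mult_left_mono sum_le_suminf simp: pair_mass_bounds)
      then show ?thesis using B[of n] by linarith
    qed
    then show ?thesis by blast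
  qed
  \<comment> \<open>Arm 2 alone suffices for the contradiction: an upper bound on its log-odds keeps
    its mass comparable to that of arm 1.\<close>
  then obtain B where B: "\<And>n. z 2 n \<le> B" using K2 by force
  obtain B' where B': "\<And>k n. k \<in> {2..K} \<Longrightarrow> z k n \<ge> \<alpha> * c * (\<Sum>s<n. q s 1 * (1 - q s 1)) - B'"
    by (rule z_lower_uniform) blast
  have z_ge: "z k n \<ge> - B'" if "k \<in> {2..K}" for k n
  proof -
    have "0 \<le> \<alpha> * c * (\<Sum>s<n. q s 1 * (1 - q s 1))"
      using \<alpha>_pos c_pos q_pos[OF one_in] q_le_1[OF one_in]
      by (intro mult_nonneg_nonneg sum_nonneg) (auto simp: less_imp_le)
    then show ?thesis using B'[OF that, of n] by linarith
  qed
  \<comment> \<open>The bound \<open>z k n \<ge> - B'\<close> in \<open>one_minus_q\<close> gives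
    \<open>1 \<le> q n 1 * (1 + real K * exp B')\<close>, so \<open>a\<close> bounds
    \<open>q n 1\<close> from below for all \<open>n\<close>.\<close>
  define a where "a = 1 / (1 + real K * exp B')"
  have a: "a > 0" unfolding a_def by (intro divide_pos_pos add_pos_nonneg) auto
  have q1: "q n 1 \<ge> a" for n
  proof -
    have "(\<Sum>k\<in>{2..K}. exp (- z k n)) \<le> (\<Sum>k\<in>{2..K}. exp B')"
      using z_ge by (intro sum_mono) (force simp: minus_le_iff)
    also have "\<dots> \<le> real K * exp B'" by (auto intro!: mult_right_mono)
    finally have "1 - q n 1 \<le> q n 1 * (real K * exp B')"
      using one_minus_q[of n] q_pos[OF one_in, of n] by simp
    then have "1 \<le> q n 1 * (1 + real K * exp B')" by (simp add: algebra_simps)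
    then show ?thesis unfolding a_def
      by (subst pos_divide_le_eq) (auto intro!: add_pos_nonneg)
  qed
  have "a * (a * exp (- B)) \<le> q n 1 * q n 2" for n
    using q1[of n] a B[of n] q_odds[of 2 n] K2 q_pos[OF one_in, of n]
    by (intro mult_mono) (auto intro!: mult_mono)
  moreover have "(\<lambda>n. q n 1 * q n 2) \<longlonglongrightarrow> 0"
    using S1[of 2] K2 by (intro summable_LIMSEQ_zero) auto
  ultimately have "a * (a * exp (- B)) \<le> 0"
    by (intro LIMSEQ_le_const) auto
  then show False using a by (simp add: mult_le_0_iff not_le[symmetric])
qed

lemma filterlim_mass: "filterlim (\<lambda>n. \<Sum>s<n. q s 1 * (1 - q s 1)) at_top sequentially"
proof -
  let ?x = "\<lambda>n. q n 1 * (1 - q n 1)"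
  have nn: "0 \<le> ?x n" for n
    using q_pos[OF one_in, of n] q_le_1[OF one_in, of n] by simp
  have mono: "mono (\<lambda>n. \<Sum>s<n. ?x s)"
    using nn by (intro monoI sum_mono2) auto
  show ?thesis unfolding filterlim_at_top eventually_sequentially
  proof
    fix Z
    have "\<exists>N. (\<Sum>s<N. ?x s) \<ge> Z"
    proof (rule ccontr)
      assume "\<not> ?thesis"
      then have *: "(\<Sum>s<n. ?x s) \<le> Z" for n by (auto simp: not_le less_imp_le)
      have "summable ?x"
        using nn *[of "Suc _"] by (intro bounded_imp_summable[of _ Z]) (auto simp: lessThan_Suc_atMost)
      then show False using not_summable by simp
    qed
    then obtain N where N: "(\<Sum>s<N. ?x s) \<ge> Z" by blast
    then show "\<exists>N. \<forall>n\<ge>N. Z \<le> (\<Sum>s<n. ?x s)"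
      using monoD[OF mono] order_trans by blast
  qed
qed

text \<open>Insert the uniform lower bound on the log-odds into \<open>one_minus_q\<close> and drop
  the factor \<open>q n 1 \<le> 1\<close>. Of the constants, only the prefactor comes from the
  path-dependent bound; the rate is \<open>\<alpha> * c\<close>.\<close>

lemma q1_odds_le:
  obtains B where "\<And>n. 1 - q n 1 \<le> B * exp (- (\<alpha> * c) * (\<Sum>s<n. q s 1 * (1 - q s 1)))"
proof -
  obtain B where B: "\<And>k n. k \<in> {2..K} \<Longrightarrow> z k n \<ge> \<alpha> * c * (\<Sum>s<n. q s 1 * (1 - q s 1)) - B"
    by (rule z_lower_uniform) blast
  have "1 - q n 1 \<le> (real (card {2..K}) * exp B) * exp (- (\<alpha> * c) * (\<Sum>s<n. q s 1 * (1 - q s 1)))" for n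
  proof -
    have "1 - q n 1 \<le> 1 * (\<Sum>k\<in>{2..K}. exp (- z k n))"
      unfolding one_minus_q using q_le_1[OF one_in, of n]
      by (intro mult_right_mono sum_nonneg) auto
    also have "\<dots> \<le> (\<Sum>k\<in>{2..K}. exp (B - \<alpha> * c * (\<Sum>s<n. q s 1 * (1 - q s 1))))"
      unfolding mult_1_left using B[of _ n] by (intro sum_mono) (simp add: diff_le_eq le_diff_eq add.commute)
    also have "\<dots> = (real (card {2..K}) * exp B) * exp (- (\<alpha> * c) * (\<Sum>s<n. q s 1 * (1 - q s 1)))"
      by (simp add: exp_diff exp_minus field_simps)
    finally show ?thesis .
  qed
  then show ?thesis by (rule that)
qed

lemma q1_limit: "(\<lambda>n. q n 1) \<longlonglongrightarrow> 1"
proof -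
  obtain B where B: "\<And>n. 1 - q n 1 \<le> B * exp (- (\<alpha> * c) * (\<Sum>s<n. q s 1 * (1 - q s 1)))"
    by (rule q1_odds_le) blast
  have "filterlim (\<lambda>n. (\<alpha> * c) * (\<Sum>s<n. q s 1 * (1 - q s 1))) at_top sequentially"
    using \<alpha>_pos c_pos by (intro filterlim_tendsto_pos_mult_at_top[OF tendsto_const] filterlim_mass) auto
  then have "(\<lambda>n. exp (- ((\<alpha> * c) * (\<Sum>s<n. q s 1 * (1 - q s 1))))) \<longlonglongrightarrow> 0"
    by (intro filterlim_compose[OF exp_at_bot] filterlim_compose[OF filterlim_uminus_at_bot_at_top])
  then have "(\<lambda>n. B * exp (- (\<alpha> * c) * (\<Sum>s<n. q s 1 * (1 - q s 1)))) \<longlonglongrightarrow> 0"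
    using tendsto_mult_right_zero by (simp add: tendsto_mult_right_zero)
  then have "(\<lambda>n. 1 - q n 1) \<longlonglongrightarrow> 0"
    by (rule tendsto_sandwich[OF _ _ tendsto_const, rotated 2])
      (use B q_le_1[OF one_in] in auto)
  from tendsto_diff[OF tendsto_const[of 1] this] show ?thesis by simp
qed

text \<open>By \<open>q1_odds_le\<close> each increment of the mass decays exponentially in the mass
  already accumulated, which is the hypothesis of \<open>exp_sum_le_linear\<close>. The
  path-dependent prefactor enters only inside the logarithm; using \<open>\<bar>B\<bar> + 1\<close>
  keeps \<open>a\<close> positive.\<close>

lemma mass_le_ln:
  obtains a where "a > 0"
    "\<And>n. (\<Sum>s<n. q s 1 * (1 - q s 1)) \<le> ln (1 + a * real n) / (\<alpha> * c)"
proof -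
  obtain B where B: "\<And>n. 1 - q n 1 \<le> B * exp (- (\<alpha> * c) * (\<Sum>s<n. q s 1 * (1 - q s 1)))"
    by (rule q1_odds_le) blast
  have \<kappa>: "\<alpha> * c > 0" using \<alpha>_pos c_pos by simp
  define a where "a = \<alpha> * c * exp (\<alpha> * c) * (\<bar>B\<bar> + 1)"
  have a: "a > 0" unfolding a_def using \<alpha>_pos c_pos by (intro mult_pos_pos) auto
  have "(\<Sum>s<n. q s 1 * (1 - q s 1)) \<le> ln (1 + a * real n) / (\<alpha> * c)" for n
  proof -
    let ?G = "\<lambda>n. \<Sum>s<n. q s 1 * (1 - q s 1)"
    have x: "0 \<le> q n 1 * (1 - q n 1)" "q n 1 * (1 - q n 1) \<le> 1 - q n 1" "1 - q n 1 \<le> 1" for n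
      using q_pos[OF one_in, of n] q_le_1[OF one_in, of n] by (auto intro!: mult_left_le_one_le)
    have "exp (\<alpha> * c * ?G n) \<le> 1 + \<alpha> * c * exp (\<alpha> * c) * (\<bar>B\<bar> + 1) * real n"
    proof (rule exp_sum_le_linear[OF _ _ \<kappa>])
      fix n
      show "0 \<le> q n 1 * (1 - q n 1)" "q n 1 * (1 - q n 1) \<le> 1" using x[of n] by linarith+
      have "B * exp (- (\<alpha> * c) * ?G n) \<le> (\<bar>B\<bar> + 1) * exp (- (\<alpha> * c) * ?G n)"
        by (intro mult_right_mono) auto
      then show "q n 1 * (1 - q n 1) \<le> (\<bar>B\<bar> + 1) * exp (- (\<alpha> * c) * ?G n)"
        using B[of n] x[of n] by linarith
    qed
    then have "\<alpha> * c * ?G n \<le> ln (1 + a * real n)"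
      unfolding a_def[symmetric] using a by (subst ln_ge_iff) (auto intro!: add_pos_nonneg)
    then show ?thesis by (subst pos_le_divide_eq[OF \<kappa>]) (simp only: mult.commute)
  qed
  with a show ?thesis by (rule that)
qed

end

section \<open>The supermartingale bound\<close>

text \<open>
  Ville's maximal inequality is proved in the form \<open>c P(\<exists>s\<le>n. W s \<ge> c) + E(W n; \<forall>s\<le>n. W s < c) \<le> E(W 0)\<close>;
  the hypothesis \<open>step\<close> is the supermartingale property on the only events where this needs it.
\<close>

lemma (in prob_space) AE_bounded_supermartingale:
  fixes W :: "nat \<Rightarrow> 'a \<Rightarrow> real"
  assumes W [measurable]: "\<And>n. W n \<in> borel_measurable M"
    and W0: "\<And>\<omega>. \<omega> \<in> space M \<Longrightarrow> W 0 \<omega> \<le> w"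
    and step: "\<And>n c. c > 0 \<Longrightarrow>
      (\<integral>\<^sup>+\<omega>. ennreal (W (Suc n) \<omega>) * indicator {\<omega> \<in> space M. \<forall>s\<le>n. W s \<omega> < c} \<omega> \<partial>M)
      \<le> (\<integral>\<^sup>+\<omega>. ennreal (W n \<omega>) * indicator {\<omega> \<in> space M. \<forall>s\<le>n. W s \<omega> < c} \<omega> \<partial>M)"
  shows "AE \<omega> in M. \<exists>B. \<forall>n. W n \<omega> \<le> B"
proof -
  \<comment> \<open>The event that the level \<open>c\<close> has not been reached up to time
    \<open>n\<close>; the estimate below follows the process only while it stays there.\<close>
  define S where "S c n = {\<omega> \<in> space M. \<forall>s\<le>n. W s \<omega> < c}" for c n
  have S [measurable]: "S c n \<in> sets M" for c n
    unfolding S_def by measurable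
  have bound: "ennreal c * emeasure M (space M - S c n) + (\<integral>\<^sup>+\<omega>. ennreal (W n \<omega>) * indicator (S c n) \<omega> \<partial>M)
      \<le> ennreal w" if "c > 0" for c n
  proof (induction n)
    case 0
    have "ennreal c * emeasure M (space M - S c 0) + (\<integral>\<^sup>+\<omega>. ennreal (W 0 \<omega>) * indicator (S c 0) \<omega> \<partial>M)
      = (\<integral>\<^sup>+\<omega>. ennreal c * indicator (space M - S c 0) \<omega> + ennreal (W 0 \<omega>) * indicator (S c 0) \<omega> \<partial>M)"
      by (subst nn_integral_add) (auto simp: nn_integral_cmult)
    also have "\<dots> \<le> (\<integral>\<^sup>+\<omega>. ennreal w \<partial>M)"
    proof (intro nn_integral_mono)
      fix \<omega> assume "\<omega> \<in> space M"
      with W0[of \<omega>] show "ennreal c * indicator (space M - S c 0) \<omega> + ennreal (W 0 \<omega>) * indicator (S c 0) \<omega> \<le> ennreal w"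
        by (auto simp: S_def indicator_def intro!: ennreal_leI)
    qed
    finally show ?case by (simp add: emeasure_space_1)
  next
    case (Suc n)
    have sub: "S c (Suc n) \<subseteq> S c n" by (auto simp: S_def)
    have "emeasure M (space M - S c (Suc n)) = emeasure M ((space M - S c n) \<union> (S c n - S c (Suc n)))"
      using sub sets.sets_into_space[OF S] by (intro arg_cong[where f = "emeasure M"]) blast
    also have "\<dots> = emeasure M (space M - S c n) + emeasure M (S c n - S c (Suc n))"
      by (intro plus_emeasure[symmetric]) auto
    finally have 1: "emeasure M (space M - S c (Suc n)) = emeasure M (space M - S c n) + emeasure M (S c n - S c (Suc n))" .
    have "ennreal c * emeasure M (S c n - S c (Suc n)) + (\<integral>\<^sup>+\<omega>. ennreal (W (Suc n) \<omega>) * indicator (S c (Suc n)) \<omega> \<partial>M)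
      = (\<integral>\<^sup>+\<omega>. ennreal c * indicator (S c n - S c (Suc n)) \<omega> + ennreal (W (Suc n) \<omega>) * indicator (S c (Suc n)) \<omega> \<partial>M)"
      by (subst nn_integral_add) (auto simp: nn_integral_cmult)
    \<comment> \<open>On \<open>S c n - S c (Suc n)\<close> the level is first reached at time
      \<open>Suc n\<close>, so there \<open>W (Suc n)\<close> is at least \<open>c\<close>.\<close>
    also have "\<dots> \<le> (\<integral>\<^sup>+\<omega>. ennreal (W (Suc n) \<omega>) * indicator (S c n) \<omega> \<partial>M)"
    proof (intro nn_integral_mono)
      fix \<omega> assume "\<omega> \<in> space M"
      show "ennreal c * indicator (S c n - S c (Suc n)) \<omega> + ennreal (W (Suc n) \<omega>) * indicator (S c (Suc n)) \<omega>
        \<le> ennreal (W (Suc n) \<omega>) * indicator (S c n) \<omega>"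
        by (auto simp: S_def indicator_def le_Suc_eq not_less intro!: ennreal_leI)
    qed
    also have "\<dots> \<le> (\<integral>\<^sup>+\<omega>. ennreal (W n \<omega>) * indicator (S c n) \<omega> \<partial>M)"
      unfolding S_def using step[OF that] .
    finally have 2: "ennreal c * emeasure M (S c n - S c (Suc n)) + (\<integral>\<^sup>+\<omega>. ennreal (W (Suc n) \<omega>) * indicator (S c (Suc n)) \<omega> \<partial>M)
      \<le> (\<integral>\<^sup>+\<omega>. ennreal (W n \<omega>) * indicator (S c n) \<omega> \<partial>M)" .
    show ?case
      unfolding 1 distrib_left add.assoc using add_left_mono[OF 2] Suc.IH by (rule order_trans)
  qed
  \<comment> \<open>The paths on which \<open>W\<close> is unbounded above. For every
    \<open>m\<close> they reach the level \<open>m + 1\<close>, so \<open>bound\<close> forces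
    \<open>(m + 1)\<close> times their probability below a fixed number.\<close>
  define N where "N = {\<omega> \<in> space M. \<forall>m::nat. \<exists>n. W n \<omega> \<ge> real (Suc m)}"
  have N [measurable]: "N \<in> sets M" unfolding N_def by measurable
  have "measure M N * real (Suc m) \<le> max w 0" for m
  proof -
    let ?c = "real (Suc m)"
    have "N \<subseteq> (\<Union>n. space M - S ?c n)"
      by (force simp: N_def S_def not_less)
    then have "emeasure M N \<le> emeasure M (\<Union>n. space M - S ?c n)"
      by (intro emeasure_mono) auto
    also have "\<dots> = (SUP n. emeasure M (space M - S ?c n))"
      by (intro SUP_emeasure_incseq[symmetric]) (auto simp: incseq_def S_def)
    finally have "ennreal ?c * emeasure M N \<le> ennreal ?c * (SUP n. emeasure M (space M - S ?c n))"
      by (intro mult_left_mono) auto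
    also have "\<dots> = (SUP n. ennreal ?c * emeasure M (space M - S ?c n))"
      by (intro SUP_mult_left_ennreal)
    also have "\<dots> \<le> ennreal w"
    proof (intro SUP_least)
      fix n
      have "ennreal ?c * emeasure M (space M - S ?c n) \<le>
        ennreal ?c * emeasure M (space M - S ?c n) + (\<integral>\<^sup>+\<omega>. ennreal (W n \<omega>) * indicator (S ?c n) \<omega> \<partial>M)"
        by simp
      also have "\<dots> \<le> ennreal w" by (rule bound) simp
      finally show "ennreal ?c * emeasure M (space M - S ?c n) \<le> ennreal w" .
    qed
    \<comment> \<open>The conversion \<open>ennreal\<close> sends negative reals to 0, whence
      \<open>max w 0\<close>.\<close>
    finally have "ennreal (?c * measure M N) \<le> ennreal (max w 0)"
      by (simp add: emeasure_eq_measure ennreal_mult max_def split: if_splits)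
         (auto simp: ennreal_neg)
    then show ?thesis by (subst (asm) ennreal_le_iff) (auto simp: mult.commute)
  qed
  note * = this
  have "measure M N = 0"
  proof (rule ccontr)
    assume "measure M N \<noteq> 0"
    then have pos: "measure M N > 0" using measure_nonneg[of M N] by linarith
    obtain m where "max w 0 / measure M N < real m" using reals_Archimedean2 by blast
    then have "max w 0 < measure M N * real m" using pos by (simp add: field_simps)
    also have "\<dots> \<le> measure M N * real (Suc m)" by (intro mult_left_mono) auto
    finally show False using *[of m] by linarith
  qed
  then have "AE \<omega> in M. \<omega> \<notin> N"
    by (intro AE_not_in) (auto simp: null_sets_def emeasure_eq_measure)
  then show ?thesis
    using AE_space
  proof eventually_elim
    case (elim \<omega>)
    then obtain m where "\<And>n. \<not> W n \<omega> \<ge> real (Suc m)" by (auto simp: N_def)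
    then show ?case by (auto simp: not_le intro!: exI[of _ "real (Suc m)"] less_imp_le)
  qed
qed

lemma exp_le_quadratic:
  fixes x :: real
  assumes "\<bar>x\<bar> \<le> 1"
  shows "exp x \<le> 1 + x + x\<^sup>2"
proof (cases "x \<ge> 0")
  case True
  then show ?thesis using exp_bound[of x] assms by simp
next
  case False
  \<comment> \<open>For negative \<open>x\<close> compare after multiplying by
    \<open>1 - x > 0\<close>: the quadratic becomes \<open>1 - x ^ 3\<close>, which is at least
    1.\<close>
  have "exp x * (1 - x) \<le> exp x * exp (- x)"
    using exp_ge_add_one_self[of "- x"] by (intro mult_left_mono) auto
  also have "\<dots> = 1" by (simp add: exp_minus)
  also have "\<dots> \<le> 1 - x ^ 3" using False by simp
  also have "\<dots> = (1 + x + x\<^sup>2) * (1 - x)" by (simp add: algebra_simps power2_eq_square power3_eq_cube)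
  finally show ?thesis using False by simp
qed

section \<open>Softmax policies and the explicit gradient step\<close>

lemma policy_pos: "K \<ge> 1 \<Longrightarrow> policy K X \<theta> a > 0"
  unfolding policy_def softmax_def by (intro divide_pos_pos sum_pos) auto

lemma policy_sum: "K \<ge> 1 \<Longrightarrow> (\<Sum>a\<in>{1..K}. policy K X \<theta> a) = 1"
proof -
  assume "K \<ge> 1"
  then have "(\<Sum>b\<in>{1..K}. exp (X b \<bullet> \<theta>)) > 0" by (intro sum_pos) auto
  then show ?thesis
    unfolding policy_def softmax_def by (simp add: sum_divide_distrib[symmetric])
qed

lemma policy_measurable [measurable]: "(\<lambda>\<theta>. policy K X \<theta> a) \<in> borel_measurable borel"
  unfolding policy_def softmax_def by measurable

lemma policy_odds: "policy K X \<theta> k = policy K X \<theta> 1 * exp (- (\<theta> \<bullet> (X 1 - X k)))"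
  unfolding policy_def softmax_def by (simp add: exp_diff exp_minus inner_diff_right inner_commute field_simps)

text \<open>The estimate vanishes off the sampled action, and its weight \<open>1 / q a\<close>
  cancels the factor \<open>q a\<close> of the one column that survives. Hence the step stays
  bounded in terms of reward and features, however small \<open>q a\<close> is.\<close>

lemma softmax_gradient_estimate:
  assumes "a \<in> {1..K}" "q a \<noteq> 0"
  shows "softmax_gradient K X q (reward_estimate q a y) = y *\<^sub>R (X a - (\<Sum>b\<in>{1..K}. q b *\<^sub>R X b))"
proof -
  have "(\<Sum>b\<in>{1..K}. ((if c = b then q c else 0) - q c * q b) * reward_estimate q a y b)
      = y * ((if c = a then 1 else 0) - q c)" for c
  proof -
    have "(\<Sum>b\<in>{1..K}. ((if c = b then q c else 0) - q c * q b) * reward_estimate q a y b)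
      = (\<Sum>b\<in>{a}. ((if c = b then q c else 0) - q c * q b) * reward_estimate q a y b)"
      using assms by (intro sum.mono_neutral_right) (auto simp: reward_estimate_def)
    also have "\<dots> = y * ((if c = a then 1 else 0) - q c)"
      using assms by (simp add: reward_estimate_def field_simps)
    finally show ?thesis .
  qed
  then have "softmax_gradient K X q (reward_estimate q a y)
      = (\<Sum>c\<in>{1..K}. (y * ((if c = a then 1 else 0) - q c)) *\<^sub>R X c)"
    unfolding softmax_gradient_def by (intro sum.cong refl arg_cong2[where f = scaleR])
  also have "\<dots> = (\<Sum>c\<in>{1..K}. y *\<^sub>R ((if c = a then X c else 0) - q c *\<^sub>R X c))"
    by (intro sum.cong refl) (auto simp: algebra_simps)
  also have "\<dots> = y *\<^sub>R (X a - (\<Sum>b\<in>{1..K}. q b *\<^sub>R X b))"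
    unfolding scaleR_sum_right[symmetric] sum_subtractf using assms by simp
  finally show ?thesis .
qed

section \<open>Support and means of the reward distributions\<close>

context stochastic_bandit
begin

lemma sets_reward_dist [simp, measurable_cong]: "sets (reward_dist \<nu> p a) = sets borel"
  unfolding reward_dist_def using sets_base by simp

lemma reward_dist_support:
  assumes "a \<in> {1..K}"
  shows "emeasure (reward_dist \<nu> p a) (UNIV - {-Rmax..Rmax}) = 0"
proof -
  have [measurable]: "p a \<in> borel_measurable \<nu>"
    using density_measurable[OF assms] sets_base by (simp cong: measurable_cong_sets)
  have "UNIV - {-Rmax..Rmax} \<in> null_sets \<nu>"
    using base_support sets_base by (auto simp: null_sets_def)
  then have "UNIV - {-Rmax..Rmax} \<in> null_sets (reward_dist \<nu> p a)"
    unfolding reward_dist_def by (subst null_sets_density_iff) (auto dest: AE_not_in)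
  then show ?thesis by auto
qed

lemma mean_reward_bound:
  assumes "a \<in> {1..K}"
  shows "\<bar>r a\<bar> \<le> Rmax"
proof -
  interpret P: prob_space "reward_dist \<nu> p a" by (rule prob_space_reward[OF assms])
  have "UNIV - {-Rmax..Rmax} \<in> null_sets (reward_dist \<nu> p a)"
    using reward_dist_support[OF assms] by (auto simp: null_sets_def)
  from AE_not_in[OF this] have ae: "AE y in reward_dist \<nu> p a. \<bar>y\<bar> \<le> Rmax"
    by eventually_elim auto
  have int: "integrable (reward_dist \<nu> p a) (\<lambda>y. y)"
    using ae by (intro P.integrable_const_bound) auto
  have "\<bar>LINT y|reward_dist \<nu> p a. y\<bar> \<le> (LINT y|reward_dist \<nu> p a. \<bar>y\<bar>)"
    by (rule integral_abs_bound)
  also have "\<dots> \<le> (LINT y|reward_dist \<nu> p a. Rmax)"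
    using ae int by (intro integral_mono_AE) auto
  finally show ?thesis using mean_reward[OF assms] by (simp add: P.prob_space)
qed

end

section \<open>The history filtration and integrals over one round\<close>

context softmax_policy_gradient
begin

abbreviation F :: "nat \<Rightarrow> 's measure" where
  "F \<equiv> history K M A R"

lemma space_F [simp]: "space (F t) = space M"
  unfolding history_def by simp

lemma action_in: "t \<ge> 1 \<Longrightarrow> \<omega> \<in> space M \<Longrightarrow> A t \<omega> \<in> {1..K}"
  using measurable_space[OF action_measurable] by auto

lemma history_space:
  "(\<lambda>\<omega>. \<lambda>s\<in>{1..<t}. (A s \<omega>, R s \<omega>)) \<in> space M \<rightarrow> space (PiM {1..<t} (\<lambda>_. count_space {1..K} \<Otimes>\<^sub>M borel))"
  using action_in by (force simp: space_PiM space_pair_measure)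

lemma history_measurable:
  "(\<lambda>\<omega>. \<lambda>s\<in>{1..<t}. (A s \<omega>, R s \<omega>)) \<in> F t \<rightarrow>\<^sub>M PiM {1..<t} (\<lambda>_. count_space {1..K} \<Otimes>\<^sub>M borel)"
  unfolding history_def
  by (rule measurable_vimage_algebra1) (rule history_space)

lemma subalgebra_F: "subalgebra M (F t)"
  unfolding subalgebra_def
proof
  have *: "(\<lambda>\<omega>. \<lambda>s\<in>{1..<t}. (A s \<omega>, R s \<omega>)) \<in> M \<rightarrow>\<^sub>M PiM {1..<t} (\<lambda>_. count_space {1..K} \<Otimes>\<^sub>M borel)"
    using action_measurable reward_measurable
    by (intro measurable_restrict measurable_Pair) auto
  show "sets (F t) \<subseteq> sets M"
  proof
    fix S assume "S \<in> sets (F t)"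
    then show "S \<in> sets M"
      unfolding history_def sets_vimage_algebra2[OF history_space] using measurable_sets[OF *] by blast
  qed
qed simp

lemma F_to_M: "f \<in> borel_measurable (F t) \<Longrightarrow> f \<in> borel_measurable M"
  by (rule measurable_from_subalg[OF subalgebra_F])

lemma past_measurable:
  assumes "1 \<le> s" "s < t"
  shows "A s \<in> F t \<rightarrow>\<^sub>M count_space {1..K}" "R s \<in> borel_measurable (F t)"
proof -
  have "(\<lambda>\<omega>. (\<lambda>s\<in>{1..<t}. (A s \<omega>, R s \<omega>)) s) \<in> F t \<rightarrow>\<^sub>M count_space {1..K} \<Otimes>\<^sub>M borel"
    using assms by (intro measurable_compose[OF history_measurable] measurable_component_singleton) auto
  then have *: "(\<lambda>\<omega>. (A s \<omega>, R s \<omega>)) \<in> F t \<rightarrow>\<^sub>M count_space {1..K} \<Otimes>\<^sub>M borel"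
    using assms by simp
  show "A s \<in> F t \<rightarrow>\<^sub>M count_space {1..K}" "R s \<in> borel_measurable (F t)"
    using measurable_compose[OF * measurable_fst] measurable_compose[OF * measurable_snd] by simp_all
qed

lemma K_pos: "K \<ge> 1"
proof -
  obtain \<omega> where "\<omega> \<in> space M" using not_empty by blast
  from action_in[OF _ this, of 1] show ?thesis by simp
qed

lemma \<theta>_Suc:
  assumes "t \<ge> 1" "\<omega> \<in> space M"
  shows "\<theta> (Suc t) \<omega> = \<theta> t \<omega> +
    (\<eta> * R t \<omega>) *\<^sub>R (X (A t \<omega>) - (\<Sum>b\<in>{1..K}. policy K X (\<theta> t \<omega>) b *\<^sub>R X b))"
proof -
  have "policy K X (\<theta> t \<omega>) (A t \<omega>) \<noteq> 0"
    using policy_pos[OF K_pos, of X "\<theta> t \<omega>" "A t \<omega>"] by simp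
  then show ?thesis
    using update[OF assms] softmax_gradient_estimate[OF action_in[OF assms], of "policy K X (\<theta> t \<omega>)" X "R t \<omega>"]
    by simp
qed

text \<open>The history at \<open>t\<close> stops before round \<open>t\<close>, but
  \<open>\<theta> t\<close> is computed from the earlier rounds alone; hence \<open>s = t\<close> is
  allowed, and the current policy is known before the action is drawn.\<close>

lemma \<theta>_measurable:
  assumes "1 \<le> s" "s \<le> t"
  shows "\<theta> s \<in> borel_measurable (F t)"
  using assms
proof (induction s rule: dec_induct)
  case base
  have "\<theta> 1 \<in> borel_measurable (F t) \<longleftrightarrow> (\<lambda>_. \<theta>\<^sub>1) \<in> borel_measurable (F t)"
    by (intro measurable_cong) (use init in simp)
  then show ?case by simp
next
  case (step n)
  then have [measurable]: "\<theta> n \<in> borel_measurable (F t)" "R n \<in> borel_measurable (F t)"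
    "A n \<in> F t \<rightarrow>\<^sub>M count_space {1..K}"
    using past_measurable[of n t] by auto
  have [measurable]: "X \<in> count_space {1..K} \<rightarrow>\<^sub>M borel" by simp
  have "\<theta> (Suc n) \<in> borel_measurable (F t) \<longleftrightarrow> (\<lambda>\<omega>. \<theta> n \<omega> +
    (\<eta> * R n \<omega>) *\<^sub>R (X (A n \<omega>) - (\<Sum>b\<in>{1..K}. policy K X (\<theta> n \<omega>) b *\<^sub>R X b))) \<in> borel_measurable (F t)"
    using step by (intro measurable_cong) (simp add: \<theta>_Suc)
  then show ?case by simp
qed

lemma action_event [measurable]: "t \<ge> 1 \<Longrightarrow> {\<omega> \<in> space M. A t \<omega> = a} \<in> sets M"
proof -
  assume t: "t \<ge> 1"
  have "A t -` ({a} \<inter> {1..K}) \<inter> space M \<in> sets M"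
    by (intro measurable_sets[OF action_measurable[OF t]]) auto
  also have "A t -` ({a} \<inter> {1..K}) \<inter> space M = {\<omega> \<in> space M. A t \<omega> = a}"
    using action_in[OF t] by auto
  finally show ?thesis .
qed

text \<open>The integrated form of \<open>sampling\<close>. The exceptional null set there depends
  on \<open>a\<close> and \<open>B\<close>; testing against bounded functions of the past removes it
  from view.\<close>

lemma integral_sampling:
  assumes t: "t \<ge> 1" and a: "a \<in> {1..K}" and B: "B \<in> sets borel"
    and h: "h \<in> borel_measurable (F t)" and bnd: "\<And>\<omega>. \<omega> \<in> space M \<Longrightarrow> \<bar>h \<omega>\<bar> \<le> b"
  shows "(LINT \<omega>|M. h \<omega> * indicator {\<omega> \<in> space M. A t \<omega> = a \<and> R t \<omega> \<in> B} \<omega>)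
    = (LINT \<omega>|M. h \<omega> * policy K X (\<theta> t \<omega>) a) * measure (reward_dist \<nu> p a) B"
proof -
  interpret sigma_finite_subalgebra M "F t"
    using subalgebra_F finite_measure_axioms
    by (intro finite_measure_subalgebra_is_sigma_finite finite_measure_subalgebra.intro
        finite_measure_subalgebra_axioms.intro)
  note [measurable] = reward_measurable[OF t] F_to_M[OF h] B action_event[OF t]
  let ?E = "{\<omega> \<in> space M. A t \<omega> = a \<and> R t \<omega> \<in> B}"
  have "?E = {\<omega> \<in> space M. A t \<omega> = a} \<inter> {\<omega> \<in> space M. R t \<omega> \<in> B}" by auto
  also have "\<dots> \<in> sets M" by measurable
  finally have [measurable]: "?E \<in> sets M" .
  have int: "integrable M (\<lambda>\<omega>. h \<omega> * indicator ?E \<omega>)"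
    using bnd by (intro integrable_const_bound[where B = b] AE_I2)
      (auto simp: indicator_def intro: order_trans[OF abs_ge_zero])
  have "(LINT \<omega>|M. h \<omega> * indicator ?E \<omega>) = (LINT \<omega>|M. h \<omega> * real_cond_exp M (F t) (indicator ?E) \<omega>)"
    by (rule real_cond_exp_intg(2)[symmetric, OF int h]) simp
  also have "\<dots> = (LINT \<omega>|M. (h \<omega> * policy K X (\<theta> t \<omega>) a) * measure (reward_dist \<nu> p a) B)"
  proof (rule integral_cong_AE)
    have [measurable]: "\<theta> t \<in> borel_measurable M"
      using \<theta>_measurable[OF t order_refl] by (rule measurable_from_subalg[OF subalgebra_F])
    show "(\<lambda>\<omega>. (h \<omega> * policy K X (\<theta> t \<omega>) a) * measure (reward_dist \<nu> p a) B) \<in> borel_measurable M"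
      by measurable
    show "AE \<omega> in M. h \<omega> * real_cond_exp M (F t) (indicator ?E) \<omega>
      = (h \<omega> * policy K X (\<theta> t \<omega>) a) * measure (reward_dist \<nu> p a) B"
      using sampling[OF t a B] by eventually_elim simp
  qed simp
  finally show ?thesis by simp
qed

text \<open>The support of the reward distributions carries over to \<open>R t\<close> by testing
  \<open>integral_sampling\<close> with \<open>h = 1\<close> and the complement of the interval,
  once for each of the finitely many arms.\<close>

lemma AE_reward_bound:
  assumes t: "t \<ge> 1"
  shows "AE \<omega> in M. \<bar>R t \<omega>\<bar> \<le> Rmax"
proof -
  note [measurable] = reward_measurable[OF t] action_event[OF t]
  let ?B = "UNIV - {-Rmax..Rmax}"
  have "AE \<omega> in M. \<not> (A t \<omega> = a \<and> R t \<omega> \<in> ?B)" if a: "a \<in> {1..K}" for a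
  proof -
    let ?E = "{\<omega> \<in> space M. A t \<omega> = a \<and> R t \<omega> \<in> ?B}"
    have "?E = {\<omega> \<in> space M. A t \<omega> = a} \<inter> {\<omega> \<in> space M. R t \<omega> \<in> ?B}" by auto
    also have "\<dots> \<in> sets M" by measurable
    finally have E: "?E \<in> sets M" .
    have "measure M ?E = (LINT \<omega>|M. 1 * indicator ?E \<omega>)" using E by simp
    also have "\<dots> = (LINT \<omega>|M. 1 * policy K X (\<theta> t \<omega>) a) * measure (reward_dist \<nu> p a) ?B"
      by (rule integral_sampling[OF t a, where b = 1]) auto
    also have "\<dots> = 0" using reward_dist_support[OF a] by (simp add: measure_def)
    finally have "?E \<in> null_sets M" using E by (auto simp: emeasure_eq_measure null_sets_def)
    from AE_not_in[OF this] show ?thesis using AE_space by eventually_elim auto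
  qed
  then have "AE \<omega> in M. \<forall>a\<in>{1..K}. \<not> (A t \<omega> = a \<and> R t \<omega> \<in> ?B)"
    by (intro AE_finite_allI) auto
  then show ?thesis
    using AE_space by eventually_elim (use action_in[OF t] in fastforce)
qed

lemma integral_action:
  assumes t: "t \<ge> 1" and a: "a \<in> {1..K}"
    and h: "h \<in> borel_measurable (F t)" and bnd: "\<And>\<omega>. \<omega> \<in> space M \<Longrightarrow> \<bar>h \<omega>\<bar> \<le> b"
  shows "(LINT \<omega>|M. h \<omega> * indicator {\<omega> \<in> space M. A t \<omega> = a} \<omega>) = (LINT \<omega>|M. h \<omega> * policy K X (\<theta> t \<omega>) a)"
proof -
  interpret P: prob_space "reward_dist \<nu> p a" by (rule prob_space_reward[OF a])
  have "space (reward_dist \<nu> p a) = UNIV"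
    using sets_eq_imp_space_eq[OF sets_reward_dist] by simp
  then have "measure (reward_dist \<nu> p a) UNIV = 1" using P.prob_space by simp
  then show ?thesis using integral_sampling[OF t a _ h bnd, of UNIV] by simp
qed

text \<open>The assumption \<open>sampling\<close> speaks of events only. A nonnegative
  \<open>h\<close>, restricted to the event \<open>A t = a\<close>, is a density on
  \<open>M\<close>; the image of the resulting measure under \<open>R t\<close> agrees on Borel sets
  with \<open>c\<close> times the reward distribution, so the two have the same first
  moment.\<close>

lemma integral_reward_nonneg:
  assumes t: "t \<ge> 1" and a: "a \<in> {1..K}"
    and h: "h \<in> borel_measurable (F t)" and bnd: "\<And>\<omega>. \<omega> \<in> space M \<Longrightarrow> \<bar>h \<omega>\<bar> \<le> b"
    and nonneg: "\<And>\<omega>. \<omega> \<in> space M \<Longrightarrow> 0 \<le> h \<omega>"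
  shows "(LINT \<omega>|M. h \<omega> * indicator {\<omega> \<in> space M. A t \<omega> = a} \<omega> * R t \<omega>)
    = (LINT \<omega>|M. h \<omega> * policy K X (\<theta> t \<omega>) a) * r a"
proof -
  note [measurable] = reward_measurable[OF t] F_to_M[OF h] action_event[OF t]
  interpret P: prob_space "reward_dist \<nu> p a" by (rule prob_space_reward[OF a])
  let ?E = "{\<omega> \<in> space M. A t \<omega> = a}"
  define w where "w \<omega> = h \<omega> * indicator ?E \<omega>" for \<omega>
  have [measurable]: "w \<in> borel_measurable M" unfolding w_def by measurable
  have w: "AE \<omega> in M. 0 \<le> w \<omega>" using nonneg by (auto simp: w_def)
  define c where "c = (LINT \<omega>|M. h \<omega> * policy K X (\<theta> t \<omega>) a)"
  have c: "0 \<le> c" unfolding c_def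
    by (intro integral_nonneg_AE AE_I2 mult_nonneg_nonneg nonneg less_imp_le[OF policy_pos[OF K_pos]])
  let ?\<mu> = "distr (density M (\<lambda>\<omega>. ennreal (w \<omega>))) borel (R t)"
  let ?\<rho> = "density (reward_dist \<nu> p a) (\<lambda>_. ennreal c)"
  have "?\<mu> = ?\<rho>"
  proof (rule measure_eqI)
    fix B assume "B \<in> sets ?\<mu>"
    then have B [measurable]: "B \<in> sets borel" by simp
    have "emeasure ?\<mu> B = (\<integral>\<^sup>+\<omega>. ennreal (w \<omega>) * indicator (R t -` B \<inter> space M) \<omega> \<partial>M)"
      by (simp add: emeasure_distr emeasure_density)
    also have "\<dots> = (\<integral>\<^sup>+\<omega>. ennreal (h \<omega> * indicator {\<omega> \<in> space M. A t \<omega> = a \<and> R t \<omega> \<in> B} \<omega>) \<partial>M)"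
      by (intro nn_integral_cong) (auto simp: w_def indicator_def)
    also have "\<dots> = ennreal (LINT \<omega>|M. h \<omega> * indicator {\<omega> \<in> space M. A t \<omega> = a \<and> R t \<omega> \<in> B} \<omega>)"
    proof (rule nn_integral_eq_integral)
      let ?E = "{\<omega> \<in> space M. A t \<omega> = a \<and> R t \<omega> \<in> B}"
      have "?E = {\<omega> \<in> space M. A t \<omega> = a} \<inter> {\<omega> \<in> space M. R t \<omega> \<in> B}" by auto
      also have "\<dots> \<in> sets M" by measurable
      finally have [measurable]: "?E \<in> sets M" .
      show "integrable M (\<lambda>\<omega>. h \<omega> * indicator ?E \<omega>)"
        using bnd by (intro integrable_const_bound[where B = b] AE_I2)
          (auto simp: indicator_def intro: order_trans[OF abs_ge_zero])
    qed (use nonneg in auto)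
    also have "\<dots> = ennreal (c * measure (reward_dist \<nu> p a) B)"
      unfolding c_def using integral_sampling[OF t a B h bnd] by simp
    also have "\<dots> = emeasure ?\<rho> B"
      using c by (simp add: emeasure_density_const P.emeasure_eq_measure ennreal_mult)
    finally show "emeasure ?\<mu> B = emeasure ?\<rho> B" .
  qed simp
  then have "(LINT y|?\<mu>. y) = (LINT y|?\<rho>. y)" by simp
  also have "(LINT y|?\<mu>. y) = (LINT \<omega>|M. w \<omega> * R t \<omega>)"
    using w by (simp add: integral_distr integral_density)
  also have "(LINT y|?\<rho>. y) = c * r a"
    using c mean_reward[OF a] by (subst integral_density) auto
  finally show ?thesis by (simp add: w_def c_def)
qed

lemma integrable_bounded_reward:
  assumes t: "t \<ge> 1" and h: "h \<in> borel_measurable M" and bnd: "\<And>\<omega>. \<omega> \<in> space M \<Longrightarrow> \<bar>h \<omega>\<bar> \<le> b"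
  shows "integrable M (\<lambda>\<omega>. h \<omega> * indicator {\<omega> \<in> space M. A t \<omega> = a} \<omega> * R t \<omega>)"
proof (rule integrable_const_bound[where B = "b * Rmax"])
  note [measurable] = reward_measurable[OF t] h action_event[OF t]
  show "(\<lambda>\<omega>. h \<omega> * indicator {\<omega> \<in> space M. A t \<omega> = a} \<omega> * R t \<omega>) \<in> borel_measurable M" by measurable
  show "AE \<omega> in M. norm (h \<omega> * indicator {\<omega> \<in> space M. A t \<omega> = a} \<omega> * R t \<omega>) \<le> b * Rmax"
    using AE_reward_bound[OF t] AE_space
  proof eventually_elim
    case (elim \<omega>)
    have "\<bar>h \<omega> * indicator {\<omega> \<in> space M. A t \<omega> = a} \<omega>\<bar> \<le> b"
      using bnd[OF elim(2)] by (auto simp: indicator_def)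
    then show ?case using elim bnd[OF elim(2)] by (auto simp: abs_mult intro!: mult_mono)
  qed
qed

text \<open>Adding the bound \<open>b\<close> makes \<open>h\<close> nonnegative; the identity for
  the constant \<open>b\<close> is then subtracted.\<close>

lemma integral_reward:
  assumes t: "t \<ge> 1" and a: "a \<in> {1..K}"
    and h: "h \<in> borel_measurable (F t)" and bnd: "\<And>\<omega>. \<omega> \<in> space M \<Longrightarrow> \<bar>h \<omega>\<bar> \<le> b"
  shows "(LINT \<omega>|M. h \<omega> * indicator {\<omega> \<in> space M. A t \<omega> = a} \<omega> * R t \<omega>)
    = (LINT \<omega>|M. h \<omega> * policy K X (\<theta> t \<omega>) a) * r a"
proof -
  let ?I = "\<lambda>\<omega>. indicator {\<omega> \<in> space M. A t \<omega> = a} \<omega>"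
  let ?p = "\<lambda>\<omega>. policy K X (\<theta> t \<omega>) a"
  have [measurable]: "\<theta> t \<in> borel_measurable M"
    using \<theta>_measurable[OF t order_refl] by (rule measurable_from_subalg[OF subalgebra_F])
  have hM [measurable]: "h \<in> borel_measurable M" by (rule F_to_M[OF h])
  have p: "0 \<le> ?p \<omega>" "?p \<omega> \<le> 1" for \<omega>
    using policy_pos[OF K_pos, of X "\<theta> t \<omega>"] policy_sum[OF K_pos, of X "\<theta> t \<omega>"]
      member_le_sum[OF a, of "policy K X (\<theta> t \<omega>)"] by (auto simp: less_imp_le)
  have ip: "integrable M (\<lambda>\<omega>. f \<omega> * ?p \<omega>)"
    if [measurable]: "f \<in> borel_measurable M" and "\<And>\<omega>. \<omega> \<in> space M \<Longrightarrow> \<bar>f \<omega>\<bar> \<le> b" for f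
  proof (rule integrable_const_bound[where B = b])
    show "AE \<omega> in M. norm (f \<omega> * ?p \<omega>) \<le> b"
    proof (rule AE_I2)
      fix \<omega> assume "\<omega> \<in> space M"
      then have "\<bar>f \<omega>\<bar> * ?p \<omega> \<le> b * 1" using that(2)[of \<omega>] p[of \<omega>] by (intro mult_mono) auto
      then show "norm (f \<omega> * ?p \<omega>) \<le> b" using p[of \<omega>] by (simp add: abs_mult)
    qed
  qed measurable
  have b: "\<omega> \<in> space M \<Longrightarrow> \<bar>b\<bar> \<le> b" for \<omega> using bnd[of \<omega>] by auto
  have 1: "(LINT \<omega>|M. (h \<omega> + b) * ?I \<omega> * R t \<omega>) = (LINT \<omega>|M. (h \<omega> + b) * ?p \<omega>) * r a"
    using h bnd by (intro integral_reward_nonneg[OF t a, where b = "2 * b"]) (force simp: abs_le_iff)+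
  have 2: "(LINT \<omega>|M. b * ?I \<omega> * R t \<omega>) = (LINT \<omega>|M. b * ?p \<omega>) * r a"
    using b by (intro integral_reward_nonneg[OF t a, where b = b]) (force simp: abs_le_iff)+
  have 3: "(LINT \<omega>|M. (h \<omega> + b) * ?I \<omega> * R t \<omega>) = (LINT \<omega>|M. h \<omega> * ?I \<omega> * R t \<omega>) + (LINT \<omega>|M. b * ?I \<omega> * R t \<omega>)"
    unfolding distrib_right using b bnd
    by (intro Bochner_Integration.integral_add integrable_bounded_reward[OF t, where b = b]) auto
  have 4: "(LINT \<omega>|M. (h \<omega> + b) * ?p \<omega>) = (LINT \<omega>|M. h \<omega> * ?p \<omega>) + (LINT \<omega>|M. b * ?p \<omega>)"
    unfolding distrib_right using b bnd
    by (intro Bochner_Integration.integral_add ip) auto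
  show ?thesis
    using 1[unfolded 3 4] by (simp only: distrib_right 2 add_right_cancel)
qed

text \<open>
  The process \<open>exp (\<langle>\<theta>\<^sub>t, u\<rangle> - \<Sum>\<^sub>s (m\<^sub>s + w\<^sub>s))\<close>, with \<open>m\<^sub>s\<close> the conditional mean and \<open>w\<^sub>s\<close> a bound for
  the conditional second moment of the increment of \<open>\<langle>\<theta>, u\<rangle>\<close>, is a supermartingale because
  \<open>exp y \<le> 1 + y + y\<^sup>2\<close> for \<open>\<bar>y\<bar> \<le> 1\<close>.
\<close>

lemma AE_linear_functional_bound:
  fixes u :: "real ^ 'd"
  defines "g \<equiv> \<lambda>a. X a \<bullet> u"
  assumes \<eta>: "\<eta> \<ge> 0"
    and small: "\<And>a b. a \<in> {1..K} \<Longrightarrow> b \<in> {1..K} \<Longrightarrow> \<eta> * Rmax * \<bar>g a - g b\<bar> \<le> 1"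
  shows "AE \<omega> in M. \<exists>B. \<forall>n. \<theta> (Suc n) \<omega> \<bullet> u \<le>
    (\<Sum>s<n. \<eta> * weighted_cov K (policy K X (\<theta> (Suc s) \<omega>)) r g
      + \<eta>\<^sup>2 * Rmax\<^sup>2 * weighted_cov K (policy K X (\<theta> (Suc s) \<omega>)) g g) + B"
proof -
  define q where "q t \<omega> = policy K X (\<theta> t \<omega>)" for t \<omega>
  define v where "v t a \<omega> = g a - (\<Sum>b\<in>{1..K}. q t \<omega> b * g b)" for t a \<omega>
  define D where "D t \<omega> = \<eta> * weighted_cov K (q t \<omega>) r g + \<eta>\<^sup>2 * Rmax\<^sup>2 * weighted_cov K (q t \<omega>) g g" for t \<omega>
  \<comment> \<open>The index is shifted by one: \<open>W n\<close> belongs to round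
    \<open>Suc n\<close>, so that \<open>W 0\<close> involves only the deterministic starting
    point.\<close>
  define W where "W n \<omega> = exp (\<theta> (Suc n) \<omega> \<bullet> u - (\<Sum>s<n. D (Suc s) \<omega>))" for n \<omega>
  have q_sum: "(\<Sum>a\<in>{1..K}. q t \<omega> a) = 1" for t \<omega>
    unfolding q_def by (rule policy_sum[OF K_pos])
  have q_nonneg: "0 \<le> q t \<omega> a" for t \<omega> a
    unfolding q_def using policy_pos[OF K_pos] by (rule less_imp_le)
  have v_bound: "\<eta> * Rmax * \<bar>v t a \<omega>\<bar> \<le> 1" if a: "a \<in> {1..K}" for t a \<omega>
  proof -
    have "v t a \<omega> = (\<Sum>b\<in>{1..K}. q t \<omega> b) * g a - (\<Sum>b\<in>{1..K}. q t \<omega> b * g b)"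
      by (simp only: v_def q_sum mult_1_left)
    also have "\<dots> = (\<Sum>b\<in>{1..K}. q t \<omega> b * (g a - g b))"
      by (simp add: sum_distrib_right sum_subtractf right_diff_distrib)
    finally have "\<bar>v t a \<omega>\<bar> \<le> (\<Sum>b\<in>{1..K}. \<bar>q t \<omega> b * (g a - g b)\<bar>)" by (simp only: sum_abs)
    then have "\<eta> * Rmax * \<bar>v t a \<omega>\<bar> \<le> \<eta> * Rmax * (\<Sum>b\<in>{1..K}. \<bar>q t \<omega> b * (g a - g b)\<bar>)"
      using \<eta> Rmax_pos by (intro mult_left_mono) auto
    also have "\<dots> = (\<Sum>b\<in>{1..K}. q t \<omega> b * (\<eta> * Rmax * \<bar>g a - g b\<bar>))"
      unfolding sum_distrib_left using q_nonneg by (intro sum.cong refl) (simp add: abs_mult)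
    also have "\<dots> \<le> (\<Sum>b\<in>{1..K}. q t \<omega> b * 1)"
      using small[OF a] q_nonneg by (intro sum_mono mult_left_mono) auto
    also have "\<dots> = 1" using q_sum by simp
    finally show ?thesis .
  qed
  have D_eq: "D t \<omega> = (\<Sum>a\<in>{1..K}. q t \<omega> a * (\<eta> * r a * v t a \<omega> + \<eta>\<^sup>2 * Rmax\<^sup>2 * (v t a \<omega>)\<^sup>2))" for t \<omega>
    unfolding D_def weighted_cov_self[OF q_sum, symmetric] v_def[symmetric]
    unfolding weighted_cov_def v_def[symmetric] sum_distrib_left sum.distrib[symmetric]
    by (intro sum.cong refl) (simp add: algebra_simps)
  \<comment> \<open>This keeps \<open>exp (- D t \<omega>)\<close> below \<open>exp 1\<close>, which
    makes \<open>h\<close> below bounded.\<close>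
  have D_lower: "D t \<omega> \<ge> -1" for t \<omega>
  proof -
    have "(\<Sum>a\<in>{1..K}. q t \<omega> a * (- 1)) \<le> D t \<omega>"
      unfolding D_eq
    proof (intro sum_mono mult_left_mono q_nonneg)
      fix a assume a: "a \<in> {1..K}"
      have "\<bar>\<eta> * r a * v t a \<omega>\<bar> \<le> \<eta> * Rmax * \<bar>v t a \<omega>\<bar>"
        unfolding abs_mult using mean_reward_bound[OF a] \<eta> by (intro mult_mono) auto
      also have "\<dots> \<le> 1" by (rule v_bound[OF a])
      finally have "- 1 \<le> \<eta> * r a * v t a \<omega>" by linarith
      then show "- 1 \<le> \<eta> * r a * v t a \<omega> + \<eta>\<^sup>2 * Rmax\<^sup>2 * (v t a \<omega>)\<^sup>2"
        by (intro add_increasing2) auto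
    qed
    then show ?thesis using q_sum by (simp add: sum_negf)
  qed
  have q_F: "(\<lambda>\<omega>. q s \<omega> a) \<in> borel_measurable (F t)" if "1 \<le> s" "s \<le> t" for s t a
    unfolding q_def using measurable_compose[OF \<theta>_measurable[OF that] policy_measurable] .
  have v_F: "v s a \<in> borel_measurable (F t)" if "1 \<le> s" "s \<le> t" for s t a
    unfolding v_def using q_F[OF that] by (intro borel_measurable_diff borel_measurable_sum borel_measurable_times) auto
  have D_F: "D s \<in> borel_measurable (F t)" if "1 \<le> s" "s \<le> t" for s t
    unfolding D_eq using q_F[OF that] v_F[OF that]
    by (intro borel_measurable_sum borel_measurable_times borel_measurable_add borel_measurable_power) auto
  have W_F: "W n \<in> borel_measurable (F t)" if "n < t" for n t
  proof -
    have [measurable]: "\<theta> (Suc n) \<in> borel_measurable (F t)" using that by (intro \<theta>_measurable) auto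
    have [measurable]: "(\<lambda>\<omega>. \<Sum>s<n. D (Suc s) \<omega>) \<in> borel_measurable (F t)"
      using that by (intro borel_measurable_sum D_F) auto
    show ?thesis unfolding W_def by measurable
  qed
  have "AE \<omega> in M. \<exists>B. \<forall>n. W n \<omega> \<le> B"
  proof (rule AE_bounded_supermartingale)
    show W_M: "W n \<in> borel_measurable M" for n
      using W_F[of n "Suc n"] by (intro F_to_M) auto
    show "W 0 \<omega> \<le> exp (\<theta>\<^sub>1 \<bullet> u)" if "\<omega> \<in> space M" for \<omega>
      using init[OF that] by (simp add: W_def)
    fix n :: nat and c :: real assume c: "c > 0"
    define t where "t = Suc n"
    have t: "t \<ge> 1" by (simp add: t_def)
    let ?S = "{\<omega> \<in> space M. \<forall>s\<le>n. W s \<omega> < c}"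
    have S_F: "?S \<in> sets (F t)"
    proof -
      have "{\<omega> \<in> space (F t). \<forall>s\<in>{..n}. W s \<omega> < c} \<in> sets (F t)"
      proof (intro sets.sets_Collect_finite_All finite_atMost)
        fix s assume "s \<in> {..n}"
        then have "W s \<in> borel_measurable (F t)" by (intro W_F) (simp add: t_def)
        then show "{\<omega> \<in> space (F t). W s \<omega> < c} \<in> sets (F t)"
          by (rule borel_measurable_less[OF _ borel_measurable_const])
      qed
      then show ?thesis by (simp only: space_F Ball_def atMost_iff)
    qed
    \<comment> \<open>On \<open>?S\<close> this is \<open>W (Suc n)\<close> without the factor
      \<open>exp Y\<close> of the new increment \<open>Y\<close>, hence measurable with respect to
      the past.\<close>
    define h where "h \<omega> = W n \<omega> * exp (- D t \<omega>) * indicator ?S \<omega>" for \<omega>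
    have h_F: "h \<in> borel_measurable (F t)"
    proof -
      have [measurable]: "W n \<in> borel_measurable (F t)" by (intro W_F) (simp add: t_def)
      note [measurable] = D_F[OF t order_refl] S_F
      show ?thesis unfolding h_def by measurable
    qed
    note h_M [measurable] = F_to_M[OF h_F]
    have h_nonneg: "0 \<le> h \<omega>" for \<omega> unfolding h_def W_def by simp
    have h_bound: "\<bar>h \<omega>\<bar> \<le> c * exp 1" for \<omega>
    proof -
      have "h \<omega> \<le> c * exp 1"
      proof (cases "\<omega> \<in> ?S")
        case True
        then show ?thesis
          unfolding h_def using D_lower[of t \<omega>] c by (auto intro!: mult_mono simp: less_imp_le)
      next
        case False
        then show ?thesis using c by (simp add: h_def)
      qed
      then show ?thesis using h_nonneg[of \<omega>] by simp
    qed
    let ?I = "\<lambda>a \<omega>. indicator {\<omega> \<in> space M. A t \<omega> = a} \<omega> :: real"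
    note [measurable] = action_event[OF t] reward_measurable[OF t] F_to_M[OF v_F[OF t order_refl]]
      F_to_M[OF q_F[OF t order_refl]] F_to_M[OF D_F[OF t order_refl]] W_M
    define L where "L = \<eta> * Rmax"
    have L: "L \<ge> 0" unfolding L_def using \<eta> Rmax_pos by simp
    \<comment> \<open>The quadratic bound for \<open>exp Y\<close> splits into a part free of the
      reward (\<open>h1\<close>, with the squared reward replaced by \<open>Rmax\<^sup>2\<close>)
      and a part linear in it (\<open>h2\<close>). These are the shapes that
      \<open>integral_action\<close> and \<open>integral_reward\<close> evaluate.\<close>
    define h1 where "h1 a \<omega> = h \<omega> * (1 + L\<^sup>2 * (v t a \<omega>)\<^sup>2)" for a \<omega>
    define h2 where "h2 a \<omega> = h \<omega> * (\<eta> * v t a \<omega>)" for a \<omega>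
    have h1_F: "h1 a \<in> borel_measurable (F t)" and h2_F: "h2 a \<in> borel_measurable (F t)" for a
      unfolding h1_def h2_def
      by (intro borel_measurable_times borel_measurable_add borel_measurable_power borel_measurable_const
          h_F v_F[OF t order_refl])+
    note [measurable] = F_to_M[OF h1_F] F_to_M[OF h2_F]
    have h1_bound: "\<bar>h1 a \<omega>\<bar> \<le> c * exp 1 * 2" if a: "a \<in> {1..K}" for a \<omega>
    proof -
      have "\<bar>L * v t a \<omega>\<bar> \<le> 1" 
        unfolding abs_mult[of L] abs_of_nonneg[OF L] unfolding L_def by (rule v_bound[OF a])
      then have "(L * v t a \<omega>)\<^sup>2 \<le> 1" by (simp add: abs_square_le_1)
      then show ?thesis unfolding h1_def abs_mult
        using h_bound c by (intro mult_mono) (auto simp: power_mult_distrib)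
    qed
    have h2_bound: "\<bar>h2 a \<omega>\<bar> \<le> c * exp 1 * (1 / Rmax)" if a: "a \<in> {1..K}" for a \<omega>
    proof -
      have "\<bar>\<eta> * v t a \<omega>\<bar> \<le> 1 / Rmax" using v_bound[OF a, of t \<omega>] \<eta> Rmax_pos
        by (simp add: abs_mult field_simps)
      then show ?thesis unfolding h2_def abs_mult[of "h \<omega>"]
        using h_bound c by (intro mult_mono) auto
    qed
    define Z where "Z \<omega> = (\<Sum>a\<in>{1..K}. h1 a \<omega> * ?I a \<omega> + h2 a \<omega> * ?I a \<omega> * R t \<omega>)" for \<omega>
    have q_le: "\<bar>q t \<omega> a\<bar> \<le> 1" if a: "a \<in> {1..K}" for a \<omega>
      using member_le_sum[OF a, of "q t \<omega>"] q_nonneg[of t \<omega>] q_sum[of t \<omega>] by simp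
    have i1: "integrable M (\<lambda>\<omega>. h1 a \<omega> * f \<omega>)"
      if "a \<in> {1..K}" and [measurable]: "f \<in> borel_measurable M" and "\<And>\<omega>. \<bar>f \<omega>\<bar> \<le> 1" for a f
    proof (rule integrable_const_bound[where B = "c * exp 1 * 2 * 1"])
      show "AE \<omega> in M. norm (h1 a \<omega> * f \<omega>) \<le> c * exp 1 * 2 * 1"
        unfolding real_norm_def abs_mult using that h1_bound[OF that(1)] c
        by (intro AE_I2 mult_mono) auto
    qed measurable
    have i2: "integrable M (\<lambda>\<omega>. h2 a \<omega> * ?I a \<omega> * R t \<omega>)" if "a \<in> {1..K}" for a
      using h2_bound[OF that] by (intro integrable_bounded_reward[OF t]) auto
    have i3: "integrable M (\<lambda>\<omega>. h2 a \<omega> * q t \<omega> a)" if a: "a \<in> {1..K}" for a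
    proof (rule integrable_const_bound[where B = "c * exp 1 * (1 / Rmax) * 1"])
      show "AE \<omega> in M. norm (h2 a \<omega> * q t \<omega> a) \<le> c * exp 1 * (1 / Rmax) * 1"
        unfolding real_norm_def abs_mult using h2_bound[OF a] q_le[OF a] c Rmax_pos
        by (intro AE_I2 mult_mono) auto
    qed measurable
    have iI: "integrable M (\<lambda>\<omega>. h1 a \<omega> * ?I a \<omega>)" if "a \<in> {1..K}" for a
      by (intro i1 that) (auto simp: indicator_def)
    have iq: "integrable M (\<lambda>\<omega>. h1 a \<omega> * q t \<omega> a)" if "a \<in> {1..K}" for a
      by (intro i1 that q_le) measurable
    have Z_int: "integrable M Z"
      unfolding Z_def by (intro Bochner_Integration.integrable_sum Bochner_Integration.integrable_add iI i2)
    have "(LINT \<omega>|M. Z \<omega>) = (\<Sum>a\<in>{1..K}. (LINT \<omega>|M. h1 a \<omega> * ?I a \<omega> + h2 a \<omega> * ?I a \<omega> * R t \<omega>))"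
      unfolding Z_def
      by (intro Bochner_Integration.integral_sum Bochner_Integration.integrable_add iI i2)
    also have "\<dots> = (\<Sum>a\<in>{1..K}. (LINT \<omega>|M. h1 a \<omega> * ?I a \<omega>) + (LINT \<omega>|M. h2 a \<omega> * ?I a \<omega> * R t \<omega>))"
      by (intro sum.cong refl Bochner_Integration.integral_add iI i2)
    also have "\<dots> = (\<Sum>a\<in>{1..K}. (LINT \<omega>|M. h1 a \<omega> * q t \<omega> a) + (LINT \<omega>|M. h2 a \<omega> * q t \<omega> a) * r a)"
      unfolding q_def using h1_bound h2_bound
      by (intro sum.cong refl arg_cong2[where f = "(+)"] integral_action[OF t _ h1_F] integral_reward[OF t _ h2_F]) auto
    also have "\<dots> = (\<Sum>a\<in>{1..K}. (LINT \<omega>|M. h1 a \<omega> * q t \<omega> a + h2 a \<omega> * q t \<omega> a * r a))"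
      by (intro sum.cong refl) (simp add: iq i3)
    also have "\<dots> = (LINT \<omega>|M. (\<Sum>a\<in>{1..K}. h1 a \<omega> * q t \<omega> a + h2 a \<omega> * q t \<omega> a * r a))"
      by (intro Bochner_Integration.integral_sum[symmetric] Bochner_Integration.integrable_add
          integrable_mult_left iq i3)
    also have "\<dots> = (LINT \<omega>|M. h \<omega> * (1 + D t \<omega>))"
    proof (intro Bochner_Integration.integral_cong refl)
      fix \<omega>
      have "(\<Sum>a\<in>{1..K}. h1 a \<omega> * q t \<omega> a + h2 a \<omega> * q t \<omega> a * r a)
        = (\<Sum>a\<in>{1..K}. h \<omega> * q t \<omega> a + h \<omega> * (q t \<omega> a * (\<eta> * r a * v t a \<omega> + \<eta>\<^sup>2 * Rmax\<^sup>2 * (v t a \<omega>)\<^sup>2)))"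
        unfolding h1_def h2_def L_def by (intro sum.cong refl) (simp add: algebra_simps power_mult_distrib)
      also have "\<dots> = h \<omega> * (1 + D t \<omega>)"
        unfolding sum.distrib sum_distrib_left[symmetric] D_eq[symmetric] q_sum by (simp add: algebra_simps)
      finally show "(\<Sum>a\<in>{1..K}. h1 a \<omega> * q t \<omega> a + h2 a \<omega> * q t \<omega> a * r a) = h \<omega> * (1 + D t \<omega>)" .
    qed
    finally have Z_eq: "(LINT \<omega>|M. Z \<omega>) = (LINT \<omega>|M. h \<omega> * (1 + D t \<omega>))" .
    have Z_ge: "AE \<omega> in M. W (Suc n) \<omega> * indicator ?S \<omega> \<le> Z \<omega>"
      using AE_reward_bound[OF t] AE_space
    proof eventually_elim
      case (elim \<omega>)
      define a where "a = A t \<omega>"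
      have a: "a \<in> {1..K}" unfolding a_def by (rule action_in[OF t elim(2)])
      define Y where "Y = \<eta> * R t \<omega> * v t a \<omega>"
      have "\<theta> (Suc t) \<omega> \<bullet> u = \<theta> t \<omega> \<bullet> u + Y"
        unfolding \<theta>_Suc[OF t elim(2)] Y_def v_def g_def q_def a_def
        by (simp add: inner_add_left inner_diff_left inner_sum_left)
      then have W_Suc: "W (Suc n) \<omega> = W n \<omega> * exp (- D t \<omega>) * exp Y"
        unfolding W_def t_def by (simp add: exp_add[symmetric] algebra_simps)
      have Y_abs: "\<bar>Y\<bar> \<le> L * \<bar>v t a \<omega>\<bar>"
        unfolding Y_def L_def abs_mult using elim \<eta> by (intro mult_right_mono mult_mono) auto
      then have Y1: "\<bar>Y\<bar> \<le> 1" using v_bound[OF a, of t \<omega>] by (simp add: L_def)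
      have "Y\<^sup>2 \<le> (L * \<bar>v t a \<omega>\<bar>)\<^sup>2"
        using power_mono[OF Y_abs abs_ge_zero, of 2] by simp
      then have "exp Y \<le> 1 + L\<^sup>2 * (v t a \<omega>)\<^sup>2 + Y"
        using exp_le_quadratic[OF Y1] by (simp add: power_mult_distrib)
      then have "h \<omega> * exp Y \<le> h \<omega> * (1 + L\<^sup>2 * (v t a \<omega>)\<^sup>2 + Y)"
        by (intro mult_left_mono h_nonneg)
      also have "\<dots> = h1 a \<omega> * ?I a \<omega> + h2 a \<omega> * ?I a \<omega> * R t \<omega>"
        using elim(2) unfolding h1_def h2_def Y_def a_def by (simp add: algebra_simps)
      also have "\<dots> = Z \<omega>"
      proof -
        have "Z \<omega> = (\<Sum>a\<in>{a}. h1 a \<omega> * ?I a \<omega> + h2 a \<omega> * ?I a \<omega> * R t \<omega>)"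
          unfolding Z_def using a by (intro sum.mono_neutral_right) (auto simp: a_def indicator_def)
        then show ?thesis by simp
      qed
      finally show ?case unfolding W_Suc h_def by (simp add: mult_ac)
    qed
    have Z_nonneg: "AE \<omega> in M. 0 \<le> Z \<omega>"
      using Z_ge by eventually_elim (auto simp: W_def intro: order_trans[rotated])
    have WS_int: "integrable M (\<lambda>\<omega>. W n \<omega> * indicator ?S \<omega>)"
    proof (rule integrable_const_bound[where B = c])
      show "AE \<omega> in M. norm (W n \<omega> * indicator ?S \<omega>) \<le> c"
        using c by (intro AE_I2) (auto simp: indicator_def W_def less_imp_le)
    qed measurable
    have "(\<integral>\<^sup>+\<omega>. ennreal (W (Suc n) \<omega>) * indicator ?S \<omega> \<partial>M) \<le> (\<integral>\<^sup>+\<omega>. ennreal (Z \<omega>) \<partial>M)"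
      using Z_ge by (intro nn_integral_mono_AE, eventually_elim)
        (auto simp: indicator_def intro!: ennreal_leI split: if_splits)
    also have "\<dots> = ennreal (LINT \<omega>|M. Z \<omega>)"
      by (rule nn_integral_eq_integral[OF Z_int Z_nonneg])
    also have "\<dots> \<le> ennreal (LINT \<omega>|M. W n \<omega> * indicator ?S \<omega>)"
      unfolding Z_eq
    proof (intro ennreal_leI integral_mono_AE' WS_int AE_I2)
      fix \<omega>
      \<comment> \<open>The inequality \<open>1 + x \<le> exp x\<close> at
        \<open>x = D t \<omega>\<close> restores exactly the compensating factor removed in
        \<open>h\<close>.\<close>
      have "h \<omega> * (1 + D t \<omega>) \<le> h \<omega> * exp (D t \<omega>)"
        by (intro mult_left_mono h_nonneg) (simp add: add.commute exp_ge_add_one_self)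
      also have "\<dots> = W n \<omega> * indicator ?S \<omega>"
        unfolding h_def by (simp add: exp_minus)
      finally show "h \<omega> * (1 + D t \<omega>) \<le> W n \<omega> * indicator ?S \<omega>" .
      show "0 \<le> W n \<omega> * indicator ?S \<omega>" by (simp add: W_def)
    qed
    also have "\<dots> = (\<integral>\<^sup>+\<omega>. ennreal (W n \<omega> * indicator ?S \<omega>) \<partial>M)"
      by (rule nn_integral_eq_integral[symmetric, OF WS_int]) (simp add: W_def)
    also have "\<dots> = (\<integral>\<^sup>+\<omega>. ennreal (W n \<omega>) * indicator ?S \<omega> \<partial>M)"
      by (intro nn_integral_cong) (auto simp: indicator_def)
    finally show "(\<integral>\<^sup>+\<omega>. ennreal (W (Suc n) \<omega>) * indicator ?S \<omega> \<partial>M) \<le>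
      (\<integral>\<^sup>+\<omega>. ennreal (W n \<omega>) * indicator ?S \<omega> \<partial>M)" .
  qed
  then show ?thesis
  proof eventually_elim
    case (elim \<omega>)
    then obtain B where B: "\<And>n. W n \<omega> \<le> B" by blast
    have "\<theta> (Suc n) \<omega> \<bullet> u \<le> (\<Sum>s<n. D (Suc s) \<omega>) + ln B" for n
    proof -
      have "B > 0" using B[of 0] by (simp add: W_def) (meson exp_gt_zero less_le_trans)
      then have "\<theta> (Suc n) \<omega> \<bullet> u - (\<Sum>s<n. D (Suc s) \<omega>) \<le> ln B"
        using B[of n] by (simp add: W_def ln_ge_iff)
      then show ?thesis by linarith
    qed
    then show ?case unfolding D_def q_def by blast
  qed
qed

text \<open>Apply the one-sided bound to the vectors \<open>l *\<^sub>R u\<close> and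
  \<open>- l *\<^sub>R u\<close> and divide by \<open>l\<close>. The mean is linear in the vector
  and the second moment quadratic, so the noise gains a factor \<open>l\<close>; a small
  \<open>l\<close> subordinates it to the drift for any positive learning rate.\<close>

lemma AE_linear_functional_abs_bound:
  fixes u :: "real ^ 'd"
  defines "g \<equiv> \<lambda>a. X a \<bullet> u"
  assumes \<eta>: "\<eta> \<ge> 0" and l: "l > 0"
    and small: "\<And>a b. a \<in> {1..K} \<Longrightarrow> b \<in> {1..K} \<Longrightarrow> \<eta> * Rmax * (l * \<bar>g a - g b\<bar>) \<le> 1"
  shows "AE \<omega> in M. \<exists>B. \<forall>n.
    \<bar>\<theta> (Suc n) \<omega> \<bullet> u - (\<Sum>s<n. \<eta> * weighted_cov K (policy K X (\<theta> (Suc s) \<omega>)) r g)\<bar>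
    \<le> (\<Sum>s<n. l * \<eta>\<^sup>2 * Rmax\<^sup>2 * weighted_cov K (policy K X (\<theta> (Suc s) \<omega>)) g g) + B"
proof -
  let ?q = "\<lambda>s \<omega>. policy K X (\<theta> (Suc s) \<omega>)"
  have side: "AE \<omega> in M. \<exists>B. \<forall>n. x * (\<theta> (Suc n) \<omega> \<bullet> u) \<le>
      (\<Sum>s<n. x * (\<eta> * weighted_cov K (?q s \<omega>) r g)
        + l * (l * \<eta>\<^sup>2 * Rmax\<^sup>2 * weighted_cov K (?q s \<omega>) g g)) + B"
    if "\<bar>x\<bar> = l" for x
  proof -
    have "\<eta> * Rmax * \<bar>X a \<bullet> (x *\<^sub>R u) - X b \<bullet> (x *\<^sub>R u)\<bar> \<le> 1" if "a \<in> {1..K}" "b \<in> {1..K}" for a b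
      using small[OF that] \<open>\<bar>x\<bar> = l\<close> by (simp add: g_def right_diff_distrib[symmetric] abs_mult)
    from AE_linear_functional_bound[OF \<eta> this]
    have "AE \<omega> in M. \<exists>B. \<forall>n. \<theta> (Suc n) \<omega> \<bullet> (x *\<^sub>R u) \<le>
      (\<Sum>s<n. \<eta> * weighted_cov K (?q s \<omega>) r (\<lambda>a. x * g a)
        + \<eta>\<^sup>2 * Rmax\<^sup>2 * weighted_cov K (?q s \<omega>) (\<lambda>a. x * g a) (\<lambda>a. x * g a)) + B"
      by (simp add: g_def)
    moreover have "\<eta> * weighted_cov K q' r (\<lambda>a. x * g a)
        + \<eta>\<^sup>2 * Rmax\<^sup>2 * weighted_cov K q' (\<lambda>a. x * g a) (\<lambda>a. x * g a)
      = x * (\<eta> * weighted_cov K q' r g) + l * (l * \<eta>\<^sup>2 * Rmax\<^sup>2 * weighted_cov K q' g g)" for q'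
    proof -
      have "x * x = l * l" using that by (metis abs_mult_self_eq)
      then have "\<eta>\<^sup>2 * Rmax\<^sup>2 * (x * (x * y)) = l * (l * \<eta>\<^sup>2 * Rmax\<^sup>2 * y)" for y
        by (simp add: mult.assoc[symmetric])
      then show ?thesis
        unfolding weighted_cov_scale_right weighted_cov_scale_left by simp
    qed
    ultimately show ?thesis by (simp only: inner_scaleR_right)
  qed
  have ae1: "AE \<omega> in M. \<exists>B. \<forall>n. l * (\<theta> (Suc n) \<omega> \<bullet> u) \<le>
      (\<Sum>s<n. l * (\<eta> * weighted_cov K (?q s \<omega>) r g)
        + l * (l * \<eta>\<^sup>2 * Rmax\<^sup>2 * weighted_cov K (?q s \<omega>) g g)) + B"
    by (rule side) (use l in simp)
  have ae2: "AE \<omega> in M. \<exists>B. \<forall>n. - l * (\<theta> (Suc n) \<omega> \<bullet> u) \<le>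
      (\<Sum>s<n. - l * (\<eta> * weighted_cov K (?q s \<omega>) r g)
        + l * (l * \<eta>\<^sup>2 * Rmax\<^sup>2 * weighted_cov K (?q s \<omega>) g g)) + B"
    by (rule side) (use l in simp)
  from ae1 ae2 show ?thesis
  proof eventually_elim
    case (elim \<omega>)
    define z where "z n = \<theta> (Suc n) \<omega> \<bullet> u" for n
    define m where "m n = (\<Sum>s<n. \<eta> * weighted_cov K (?q s \<omega>) r g)" for n
    define w where "w n = (\<Sum>s<n. l * \<eta>\<^sup>2 * Rmax\<^sup>2 * weighted_cov K (?q s \<omega>) g g)" for n
    obtain B1 where B1: "\<And>n. l * z n \<le> l * m n + l * w n + B1"
      using elim(1) unfolding sum.distrib sum_distrib_left[symmetric] z_def m_def w_def by blast
    obtain B2 where B2: "\<And>n. - l * z n \<le> - l * m n + l * w n + B2"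
      using elim(2) unfolding sum.distrib sum_distrib_left[symmetric] z_def m_def w_def by blast
    have "\<bar>z n - m n\<bar> \<le> w n + max B1 B2 / l" for n
    proof -
      have "l * \<bar>z n - m n\<bar> = \<bar>l * z n - l * m n\<bar>"
        using l by (simp add: right_diff_distrib[symmetric] abs_mult)
      also have "\<dots> \<le> l * w n + max B1 B2" using B1[of n] B2[of n] by simp
      also have "\<dots> = l * (w n + max B1 B2 / l)" using l by (simp add: field_simps)
      finally show ?thesis using l by simp
    qed
    then show ?case unfolding z_def m_def w_def by blast
  qed
qed

end

section \<open>Logarithmic growth of the accumulated suboptimality\<close>

lemma finite_upper_bound:
  fixes f :: "'a \<Rightarrow> real"
  assumes "finite S"
  obtains L where "L \<ge> 1" "\<And>x. x \<in> S \<Longrightarrow> f x \<le> L"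
proof
  show "max 1 (Max (f ` S)) \<ge> 1" by simp
  show "f x \<le> max 1 (Max (f ` S))" if "x \<in> S" for x
    using assms that by (intro max.coboundedI2 Max_ge) auto
qed

context softmax_policy_gradient
begin

text \<open>Almost every path is an instance of \<open>log_odds\<close>, with the log-odds read off
  in the directions \<open>X 1 - X k\<close>. The drift constants do not depend on the path, so
  \<open>\<kappa>\<close> can be fixed before it, while \<open>a\<close> cannot.\<close>

lemma AE_mass_le_ln:
  assumes K2: "K \<ge> 2" and \<eta>: "\<eta> > 0"
    and mono: "\<And>i j. i \<in> {1..K} \<Longrightarrow> j \<in> {1..K} \<Longrightarrow> i < j \<Longrightarrow> r i > r j"
    and geom: "\<And>i j k. i \<in> {1..K} \<Longrightarrow> j \<in> {1..K} \<Longrightarrow> k \<in> {1..K} \<Longrightarrow> i < j \<Longrightarrow> i < k \<Longrightarrow>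
      (X i - X j) \<bullet> (X 1 - X k) \<ge> 0"
    and geom1: "\<And>j k. j \<in> {2..K} \<Longrightarrow> k \<in> {2..K} \<Longrightarrow> (X 1 - X j) \<bullet> (X 1 - X k) > 0"
  obtains \<kappa> where "\<kappa> > 0"
    "AE \<omega> in M. (\<lambda>n. policy K X (\<theta> (Suc n) \<omega>) 1) \<longlonglongrightarrow> 1 \<and>
      (\<exists>a>0. \<forall>n. (\<Sum>s<n. policy K X (\<theta> (Suc s) \<omega>) 1 * (1 - policy K X (\<theta> (Suc s) \<omega>) 1))
         \<le> ln (1 + a * real n) / \<kappa>)"
proof -
  define g where "g k a = X a \<bullet> (X 1 - X k)" for k a
  have g_diff: "g k i - g k j = (X i - X j) \<bullet> (X 1 - X k)" for k i j
    by (simp add: g_def inner_diff_left)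
  let ?I = "{1..K}"
  \<comment> \<open>One constant for reward gaps, feature gaps and their quotients; for
    \<open>i = j\<close> the quotient is 0 by the convention on division by zero.\<close>
  obtain L where L1: "L \<ge> 1" and L0: "\<And>x. x \<in> ?I \<times> ?I \<times> ?I \<Longrightarrow>
      (case x of (k, i, j) \<Rightarrow> \<bar>r i - r j\<bar> + \<bar>g k i - g k j\<bar> + \<bar>g k i - g k j\<bar> / \<bar>r i - r j\<bar>) \<le> L"
    by (rule finite_upper_bound[of "?I \<times> ?I \<times> ?I" "\<lambda>(k, i, j).
          \<bar>r i - r j\<bar> + \<bar>g k i - g k j\<bar> + \<bar>g k i - g k j\<bar> / \<bar>r i - r j\<bar>"]) simp_all
  have L: "\<bar>r i - r j\<bar> \<le> L" "\<bar>g k i - g k j\<bar> \<le> L" "\<bar>g k i - g k j\<bar> / \<bar>r i - r j\<bar> \<le> L"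
    if "i \<in> ?I" "j \<in> ?I" "k \<in> ?I" for i j k
  proof -
    have "\<bar>r i - r j\<bar> + \<bar>g k i - g k j\<bar> + \<bar>g k i - g k j\<bar> / \<bar>r i - r j\<bar> \<le> L"
      using L0[of "(k, i, j)"] that by simp
    moreover have "0 \<le> \<bar>g k i - g k j\<bar> / \<bar>r i - r j\<bar>" by simp
    ultimately show "\<bar>r i - r j\<bar> \<le> L" "\<bar>g k i - g k j\<bar> \<le> L" "\<bar>g k i - g k j\<bar> / \<bar>r i - r j\<bar> \<le> L"
      by linarith+
  qed
  have gap: "r i \<noteq> r j" if "i \<in> ?I" "j \<in> ?I" "i \<noteq> j" for i j
    using mono[of i j] mono[of j i] that by force
  \<comment> \<open>For distinct arms, the smaller index of the pair is the better arm and lies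
    below \<open>k\<close>, so \<open>geom\<close> applies to it against the other arm and
    \<open>k\<close>.\<close>
  have sign: "(r i - r j) * (g k i - g k j) \<ge> 0"
    if "i \<in> ?I" "j \<in> ?I" "k \<in> ?I" "\<not> (k \<le> i \<and> k \<le> j)" for i j k
  proof (cases i j rule: linorder_cases)
    case less
    then show ?thesis using mono[of i j] geom[of i j k] that by (auto simp: g_diff)
  next
    case greater
    then have "(r j - r i) * (g k j - g k i) \<ge> 0"
      using mono[of j i] geom[of j i k] that by (auto simp: g_diff)
    then show ?thesis by (simp add: algebra_simps)
  qed simp
  have dom: "(g k i - g k j) * (g k i - g k j) \<le> L * ((r i - r j) * (g k i - g k j))"
    if ijk: "i \<in> ?I" "j \<in> ?I" "k \<in> ?I" "\<not> (k \<le> i \<and> k \<le> j)" for i j k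
  proof (cases "i = j")
    case False
    have "\<bar>g k i - g k j\<bar> \<le> L * \<bar>r i - r j\<bar>"
      using L(3)[OF ijk(1-3)] gap[OF ijk(1,2) False] by (simp add: divide_le_eq)
    then have "\<bar>g k i - g k j\<bar> * \<bar>g k i - g k j\<bar> \<le> (L * \<bar>r i - r j\<bar>) * \<bar>g k i - g k j\<bar>"
      by (intro mult_right_mono) auto
    also have "\<dots> = L * \<bar>(r i - r j) * (g k i - g k j)\<bar>" by (simp add: abs_mult)
    also have "\<bar>(r i - r j) * (g k i - g k j)\<bar> = (r i - r j) * (g k i - g k j)"
      using sign[OF ijk] by simp
    finally show ?thesis by simp
  qed simp
  \<comment> \<open>The products in question are positive and finite in number; an upper bound on
    their reciprocals yields the common lower bound \<open>c\<close>.\<close>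
  obtain c' where c': "c' \<ge> 1" and c'_bound: "\<And>x. x \<in> {2..K} \<times> {2..K} \<Longrightarrow>
      (case x of (k, j) \<Rightarrow> 1 / ((r 1 - r j) * (g k 1 - g k j))) \<le> c'"
    by (rule finite_upper_bound[of "{2..K} \<times> {2..K}" "\<lambda>(k, j). 1 / ((r 1 - r j) * (g k 1 - g k j))"]) simp_all
  define c where "c = 1 / c'"
  have c: "c > 0" using c' by (simp add: c_def)
  have c_le: "c \<le> (r 1 - r j) * (g k 1 - g k j)" if "j \<in> {2..K}" "k \<in> {2..K}" for j k
  proof -
    have "(r 1 - r j) * (g k 1 - g k j) > 0"
      using mono[of 1 j] geom1[OF that] that K2 by (auto simp: g_diff)
    then show ?thesis
      using c'_bound[of "(k, j)"] c' that by (simp add: c_def field_simps)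
  qed
  \<comment> \<open>This value makes \<open>y + 2 * Rmax * y = 1\<close>. It gives both
    \<open>y \<le> 1\<close>, the smallness needed for the supermartingale, and
    \<open>Rmax * y \<le> 1 / 2\<close>, which caps the noise coefficient at
    \<open>\<eta> / 2\<close>.\<close>
  define l where "l = 1 / (\<eta> * Rmax * L * (1 + 2 * Rmax))"
  have pos: "\<eta> * Rmax * L * (1 + 2 * Rmax) > 0" using \<eta> Rmax_pos L1 by simp
  have l: "l > 0" using pos by (simp add: l_def)
  define y where "y = \<eta> * Rmax * (l * L)"
  have y: "y > 0" unfolding y_def using \<eta> Rmax_pos l L1 by simp
  have "l * (\<eta> * Rmax * L * (1 + 2 * Rmax)) = 1" unfolding l_def using less_imp_neq[OF pos] by (metis nonzero_divide_eq_eq)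
  then have y1: "y + 2 * Rmax * y = 1" by (simp add: y_def algebra_simps)
  have "0 < Rmax * y" using y Rmax_pos by simp
  with y y1 have l1: "y \<le> 1" and "Rmax * y \<le> 1 / 2" by linarith+
  then have "\<eta> * (Rmax * y) \<le> \<eta> * (1 / 2)" using \<eta> by (intro mult_left_mono) auto
  then have l2: "l * \<eta>\<^sup>2 * Rmax\<^sup>2 * L \<le> \<eta> / 2"
    by (simp add: y_def power2_eq_square mult_ac)
  have "AE \<omega> in M. \<exists>B. \<forall>n.
    \<bar>\<theta> (Suc n) \<omega> \<bullet> (X 1 - X k) - (\<Sum>s<n. \<eta> * weighted_cov K (policy K X (\<theta> (Suc s) \<omega>)) r (g k))\<bar>
    \<le> (\<Sum>s<n. l * \<eta>\<^sup>2 * Rmax\<^sup>2 * weighted_cov K (policy K X (\<theta> (Suc s) \<omega>)) (g k) (g k)) + B"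
    if "k \<in> {2..K}" for k
    unfolding g_def
  proof (rule AE_linear_functional_abs_bound)
    fix a b assume ab: "a \<in> ?I" "b \<in> ?I"
    have "\<eta> * Rmax * (l * \<bar>g k a - g k b\<bar>) \<le> \<eta> * Rmax * (l * L)"
      using L(2)[OF ab, of k] that l \<eta> Rmax_pos by (intro mult_left_mono) auto
    with l1[unfolded y_def] show "\<eta> * Rmax * (l * \<bar>X a \<bullet> (X 1 - X k) - X b \<bullet> (X 1 - X k)\<bar>) \<le> 1"
      by (simp add: g_def)
  qed (use \<eta> l in auto)
  then have "AE \<omega> in M. \<forall>k\<in>{2..K}. \<exists>B. \<forall>n.
    \<bar>\<theta> (Suc n) \<omega> \<bullet> (X 1 - X k) - (\<Sum>s<n. \<eta> * weighted_cov K (policy K X (\<theta> (Suc s) \<omega>)) r (g k))\<bar>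
    \<le> (\<Sum>s<n. l * \<eta>\<^sup>2 * Rmax\<^sup>2 * weighted_cov K (policy K X (\<theta> (Suc s) \<omega>)) (g k) (g k)) + B"
    by (intro AE_finite_allI) auto
  then have "AE \<omega> in M. (\<lambda>n. policy K X (\<theta> (Suc n) \<omega>) 1) \<longlonglongrightarrow> 1 \<and>
      (\<exists>a>0. \<forall>n. (\<Sum>s<n. policy K X (\<theta> (Suc s) \<omega>) 1 * (1 - policy K X (\<theta> (Suc s) \<omega>) 1))
         \<le> ln (1 + a * real n) / (\<eta> / 4 * c))"
  proof eventually_elim
    case (elim \<omega>)
    define q where "q n = policy K X (\<theta> (Suc n) \<omega>)" for n
    define z where "z k n = \<theta> (Suc n) \<omega> \<bullet> (X 1 - X k)" for k n
    define d where "d k n = pair_mass K (\<lambda>i j. \<not> (k \<le> i \<and> k \<le> j)) (\<lambda>i j. (r i - r j) * (g k i - g k j)) (q n)" for k n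
    define e where "e k n = pair_mass K (\<lambda>i j. i \<noteq> j \<and> k \<le> i \<and> k \<le> j) (\<lambda>_ _. 1) (q n)" for k n
    have q_pos: "q n i > 0" for n i
      unfolding q_def by (rule policy_pos[OF K_pos])
    then have q_nn: "q n i \<ge> 0" for n i by (rule less_imp_le)
    have q_sum: "(\<Sum>i\<in>?I. q n i) = 1" for n
      unfolding q_def by (rule policy_sum[OF K_pos])
    have e_nn: "0 \<le> e k n" for k n
      unfolding e_def by (intro pair_mass_nonneg q_nn) simp
    have d_nn: "0 \<le> d k n" if "k \<in> {2..K}" for k n
      unfolding d_def using that by (intro pair_mass_nonneg q_nn sign) auto
    have cov: "2 * weighted_cov K (q n) r (g k) \<ge> d k n - L\<^sup>2 * e k n"
        "2 * weighted_cov K (q n) r (g k) \<le> d k n + L\<^sup>2 * e k n"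
        "2 * weighted_cov K (q n) (g k) (g k) \<le> L * d k n + L\<^sup>2 * e k n"
        "d k n \<le> L\<^sup>2 * pair_mass K (\<noteq>) (\<lambda>_ _. 1) (q n)" if k: "k \<in> {2..K}" for k n
      unfolding d_def e_def using k
      by (intro weighted_cov_drift_bounds q_nn q_sum L dom; simp)+
    have LL: "L \<le> L\<^sup>2" "1 \<le> L\<^sup>2"
      using L1 by (auto simp: power2_eq_square mult_ge1_I)
    have noise: "l * \<eta>\<^sup>2 * Rmax\<^sup>2 * weighted_cov K (q n) (g k) (g k) \<le> \<eta> / 4 * d k n + \<eta> / 4 * L\<^sup>2 * e k n"
      if k: "k \<in> {2..K}" for k n
    proof -
      have "l * \<eta>\<^sup>2 * Rmax\<^sup>2 * weighted_cov K (q n) (g k) (g k)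
        \<le> l * \<eta>\<^sup>2 * Rmax\<^sup>2 * ((L * d k n + L\<^sup>2 * e k n) / 2)"
        using cov(3)[OF k, of n] l by (intro mult_left_mono) auto
      also have "\<dots> = (l * \<eta>\<^sup>2 * Rmax\<^sup>2 * L) * ((d k n + L * e k n) / 2)"
        by (simp add: algebra_simps power2_eq_square add_divide_distrib)
      also have "\<dots> \<le> \<eta> / 2 * ((d k n + L * e k n) / 2)"
        using l2 d_nn[OF k] e_nn L1 by (intro mult_right_mono) auto
      also have "\<dots> \<le> \<eta> / 2 * ((d k n + L\<^sup>2 * e k n) / 2)"
        using \<eta> LL e_nn[of k n] by (intro mult_left_mono divide_right_mono add_left_mono mult_right_mono) auto
      finally show ?thesis by (simp add: field_simps)
    qed
    \<comment> \<open>The drift gives \<open>\<eta> / 2\<close> times \<open>d\<close> and the noise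
      uses at most half of it, leaving \<open>\<eta> / 4\<close>. On the error mass the coefficients
      add up to three quarters of \<open>\<eta> * L\<^sup>2\<close>; since
      \<open>1 \<le> L\<^sup>2\<close>, the same constant serves for \<open>d\<close> in the upper
      bound.\<close>
    interpret log_odds K q z d c "L\<^sup>2" "\<eta> / 4" "\<eta> * L\<^sup>2"
    proof
      show "2 \<le> K" by (rule K2)
      show "0 < q n i" for n i by (rule q_pos)
      show "(\<Sum>i\<in>?I. q n i) = 1" for n by (rule q_sum)
      show "q n k = q n 1 * exp (- z k n)" for n k
        unfolding q_def z_def by (rule policy_odds)
      show "0 < c" by (rule c)
      show "0 < \<eta> / 4" "0 \<le> \<eta> * L\<^sup>2" using \<eta> by auto
      show "d k n \<le> L\<^sup>2 * pair_mass K (\<noteq>) (\<lambda>_ _. 1) (q n)" if "k \<in> {2..K}" for k n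
        by (rule cov(4)[OF that])
      show "c * (q n 1 * (1 - q n 1)) \<le> d k n" if k: "k \<in> {2..K}" for k n
      proof -
        have "c * (q n 1 * (1 - q n 1)) = pair_mass K (\<lambda>i j. i = 1 \<and> j \<noteq> 1) (\<lambda>_ _. c * 1) (q n)"
          unfolding pair_mass_cmult pair_mass_first[OF q_sum K_pos] ..
        also have "\<dots> \<le> d k n"
          unfolding d_def
        proof (intro pair_mass_mono q_nn)
          fix i j assume ij: "i \<in> ?I" "j \<in> ?I"
          then show "(if i = 1 \<and> j \<noteq> 1 then c * 1 else 0)
            \<le> (if \<not> (k \<le> i \<and> k \<le> j) then (r i - r j) * (g k i - g k j) else 0)"
            using sign[of i j k] c_le[of j k] k by auto
        qed
        finally show ?thesis .
      qed
      fix k assume k: "k \<in> {2..K}"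
      obtain B where B: "\<And>n. \<bar>z k n - (\<Sum>s<n. \<eta> * weighted_cov K (q s) r (g k))\<bar>
          \<le> (\<Sum>s<n. l * \<eta>\<^sup>2 * Rmax\<^sup>2 * weighted_cov K (q s) (g k) (g k)) + B"
        using elim k unfolding z_def q_def by blast
      have noise_sum: "(\<Sum>s<n. l * \<eta>\<^sup>2 * Rmax\<^sup>2 * weighted_cov K (q s) (g k) (g k))
          \<le> \<eta> / 4 * (\<Sum>s<n. d k s) + \<eta> / 4 * L\<^sup>2 * (\<Sum>s<n. e k s)" for n
        unfolding sum_distrib_left sum.distrib[symmetric] by (intro sum_mono noise[OF k])
      have drift: "(\<Sum>s<n. \<eta> * weighted_cov K (q s) r (g k))
          \<ge> \<eta> / 2 * (\<Sum>s<n. d k s) - \<eta> / 2 * L\<^sup>2 * (\<Sum>s<n. e k s)" for n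
        unfolding sum_distrib_left sum_subtractf[symmetric]
      proof (intro sum_mono)
        fix s
        show "\<eta> / 2 * d k s - \<eta> / 2 * L\<^sup>2 * e k s \<le> \<eta> * weighted_cov K (q s) r (g k)"
          using mult_left_mono[OF cov(1)[OF k, of s], of "\<eta> / 2"] \<eta> by (simp add: algebra_simps)
      qed
      have drift': "(\<Sum>s<n. \<eta> * weighted_cov K (q s) r (g k))
          \<le> \<eta> / 2 * (\<Sum>s<n. d k s) + \<eta> / 2 * L\<^sup>2 * (\<Sum>s<n. e k s)" for n
        unfolding sum_distrib_left sum.distrib[symmetric]
      proof (intro sum_mono)
        fix s
        show "\<eta> * weighted_cov K (q s) r (g k) \<le> \<eta> / 2 * d k s + \<eta> / 2 * L\<^sup>2 * e k s"
          using mult_left_mono[OF cov(2)[OF k, of s], of "\<eta> / 2"] \<eta> by (simp add: algebra_simps)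
      qed
      have E: "0 \<le> \<eta> * L\<^sup>2 * (\<Sum>s<n. e k s)" for n
        using \<eta> e_nn by (intro mult_nonneg_nonneg sum_nonneg) auto
      have D: "0 \<le> (\<Sum>s<n. d k s)" for n
        using d_nn[OF k] by (intro sum_nonneg) auto
      have "z k n \<ge> \<eta> / 4 * (\<Sum>s<n. d k s) - \<eta> * L\<^sup>2 * (\<Sum>s<n. e k s) - B" for n
        using B[of n] noise_sum[of n] drift[of n] E[of n] by (simp add: abs_le_iff)
      then show "\<exists>B. \<forall>n. z k n \<ge> \<eta> / 4 * (\<Sum>s<n. d k s)
          - \<eta> * L\<^sup>2 * (\<Sum>s<n. pair_mass K (\<lambda>i j. i \<noteq> j \<and> k \<le> i \<and> k \<le> j) (\<lambda>_ _. 1) (q s)) - B"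
        unfolding e_def by blast
      have "z k n \<le> \<eta> * L\<^sup>2 * (\<Sum>s<n. d k s) + \<eta> * L\<^sup>2 * (\<Sum>s<n. e k s) + B" for n
      proof -
        have "\<eta> * 1 * (\<Sum>s<n. d k s) \<le> \<eta> * L\<^sup>2 * (\<Sum>s<n. d k s)"
          using \<eta> LL D by (intro mult_right_mono mult_left_mono) auto
        moreover have "0 \<le> \<eta> * (\<Sum>s<n. d k s)" using \<eta> D by simp
        ultimately show ?thesis
          using B[of n] noise_sum[of n] drift'[of n] E[of n] by (simp add: abs_le_iff)
      qed
      then show "\<exists>B. \<forall>n. z k n \<le> \<eta> * L\<^sup>2 * (\<Sum>s<n. d k s)
          + \<eta> * L\<^sup>2 * (\<Sum>s<n. pair_mass K (\<lambda>i j. i \<noteq> j \<and> k \<le> i \<and> k \<le> j) (\<lambda>_ _. 1) (q s)) + B"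
        unfolding e_def by blast
    qed
    obtain a where "a > 0" "\<And>n. (\<Sum>s<n. q s 1 * (1 - q s 1)) \<le> ln (1 + a * real n) / (\<eta> / 4 * c)"
      by (rule mass_le_ln) blast
    then show ?case using q1_limit unfolding q_def by blast
  qed
  moreover have "\<eta> / 4 * c > 0" using \<eta> c by simp
  ultimately show ?thesis using that by blast
qed

section \<open>From the mass of arm 1 to the regret bound\<close>

lemma suboptimality_le:
  "r 1 - (\<Sum>a\<in>{1..K}. policy K X x a * r a) \<le> 2 * Rmax * (1 - policy K X x 1)"
proof -
  let ?q = "policy K X x"
  have one: "1 \<in> {1..K}" using K_pos by simp
  have split: "{1..K} = insert 1 {2..K}" using K_pos by auto
  have "r 1 - (\<Sum>a\<in>{1..K}. ?q a * r a) = (\<Sum>a\<in>{1..K}. ?q a) * r 1 - (\<Sum>a\<in>{1..K}. ?q a * r a)"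
    by (simp only: policy_sum[OF K_pos] mult_1_left)
  also have "\<dots> = (\<Sum>a\<in>{1..K}. ?q a * (r 1 - r a))"
    by (simp only: sum_distrib_right sum_subtractf[symmetric] right_diff_distrib)
  also have "\<dots> = (\<Sum>a\<in>{2..K}. ?q a * (r 1 - r a))"
    unfolding split by simp
  also have "\<dots> \<le> (\<Sum>a\<in>{2..K}. ?q a * (2 * Rmax))"
  proof (intro sum_mono mult_left_mono)
    fix a assume "a \<in> {2..K}"
    then have "\<bar>r a\<bar> \<le> Rmax" by (intro mean_reward_bound) auto
    with mean_reward_bound[OF one] show "r 1 - r a \<le> 2 * Rmax" by linarith
    show "0 \<le> ?q a" using policy_pos[OF K_pos] by (rule less_imp_le)
  qed
  also have "\<dots> = 2 * Rmax * (\<Sum>a\<in>{2..K}. ?q a)" by (simp add: sum_distrib_right[symmetric])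
  also have "(\<Sum>a\<in>{2..K}. ?q a) = 1 - ?q 1"
    using policy_sum[OF K_pos, of X x] unfolding split by simp
  finally show ?thesis .
qed

end

text \<open>Translates rounds \<open>s \<ge> 1\<close> into indices \<open>n = s - 1\<close>; the
  terms before \<open>\<tau>\<close> may be added because \<open>x\<close> is nonnegative.\<close>

lemma sum_tail_le_partial:
  fixes x y :: "nat \<Rightarrow> real"
  assumes "\<tau> \<ge> 1" "\<And>n. 0 \<le> x n" "c \<ge> 0" "\<And>n. Suc n \<ge> \<tau> \<Longrightarrow> y (Suc n) \<le> c * x n"
  shows "(\<Sum>s=\<tau>..T. y s) \<le> c * (\<Sum>n<T. x n)"
proof -
  have "(\<Sum>s=\<tau>..T. y s) \<le> (\<Sum>s=\<tau>..T. c * x (s - 1))"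
  proof (intro sum_mono)
    fix s assume "s \<in> {\<tau>..T}"
    then show "y s \<le> c * x (s - 1)" using assms(1) assms(4)[of "s - 1"] by simp
  qed
  also have "\<dots> \<le> (\<Sum>s=1..T. c * x (s - 1))"
    using assms by (intro sum_mono2) auto
  also have "\<dots> = (\<Sum>n<T. c * x n)"
    by (rule sum.reindex_bij_witness[of _ Suc "\<lambda>s. s - 1"]) auto
  finally show ?thesis by (simp add: sum_distrib_left)
qed

theorem theorem12:
  fixes K :: nat and Rmax :: real and \<nu> :: "real measure"
    and p :: "nat \<Rightarrow> real \<Rightarrow> real" and r :: "nat \<Rightarrow> real" and M :: "'s measure"
    and X :: "nat \<Rightarrow> real ^ 'd" and \<eta> :: real and \<theta>\<^sub>1 :: "real ^ 'd"
    and A :: "nat \<Rightarrow> 's \<Rightarrow> nat" and R :: "nat \<Rightarrow> 's \<Rightarrow> real"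
    and \<theta> :: "nat \<Rightarrow> 's \<Rightarrow> real ^ 'd"
    and a_star :: nat
  assumes "softmax_policy_gradient K Rmax \<nu> p r M X \<eta> \<theta>\<^sub>1 A R \<theta>"
    and "\<eta> > 0"
    and "CARD('d) \<le> K"
    and "\<And>i j. i \<in> {1..K} \<Longrightarrow> j \<in> {1..K} \<Longrightarrow> i < j \<Longrightarrow> r i > r j"
    and "a_star = 1"
    and "\<And>i j k. i \<in> {1..K} \<Longrightarrow> j \<in> {1..K} \<Longrightarrow> k \<in> {1..K} \<Longrightarrow> r i > r j \<Longrightarrow> r i > r k \<Longrightarrow>
           (if i = a_star \<or> j = k then (X i - X j) \<bullet> (X a_star - X k) > 0
            else (X i - X j) \<bullet> (X a_star - X k) \<ge> 0)"
  shows "\<exists>C>0. AE \<omega> in M. \<exists>\<tau>\<ge>1. \<forall>T>\<tau>.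
    (\<Sum>s=\<tau>..T. r a_star - (\<Sum>a\<in>{1..K}. policy K X (\<theta> s \<omega>) a * r a)) / (real T - real \<tau>)
    \<le> 2 * Rmax * ((real K - 1) / C * ln (C * real T + exp C) + pi\<^sup>2 * (real K - 1) / (6 * C))
        / (real T - real \<tau>)"
proof -
  interpret softmax_policy_gradient K Rmax \<nu> p r M X \<eta> \<theta>\<^sub>1 A R \<theta> by fact
  note \<eta> = assms(2) and mono = assms(4) and a_star = assms(5) and geom = assms(6)[unfolded assms(5)]
  let ?reg = "\<lambda>\<omega> s. r 1 - (\<Sum>a\<in>{1..K}. policy K X (\<theta> s \<omega>) a * r a)"
  let ?b = "\<lambda>C T. 2 * Rmax * ((real K - 1) / C * ln (C * real T + exp C) + pi\<^sup>2 * (real K - 1) / (6 * C))"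
  \<comment> \<open>The common positive denominator is divided in only at the end. \<open>C\<close>
    is chosen before the sample path, \<open>\<tau>\<close> after it.\<close>
  have "\<exists>C>0. AE \<omega> in M. \<exists>\<tau>\<ge>1. \<forall>T>\<tau>. (\<Sum>s=\<tau>..T. ?reg \<omega> s) \<le> ?b C T"
  proof (cases "K \<ge> 2")
    \<comment> \<open>With a single arm both the regret and the bound are zero, and
      \<open>C = 1\<close> will do.\<close>
    case False
    then have "K = 1" using K_pos by simp
    then have "?reg \<omega> s = 0" "?b 1 T = 0" for \<omega> s T
      using policy_sum[of K X "\<theta> s \<omega>"] by simp_all
    then have "(\<Sum>s=\<tau>..T. ?reg \<omega> s) \<le> ?b 1 T" for \<tau> \<omega> T
      by (simp only: sum.neutral_const)
    then have "\<exists>\<tau>\<ge>1. \<forall>T>\<tau>. (\<Sum>s=\<tau>..T. ?reg \<omega> s) \<le> ?b 1 T" for \<omega>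
      by blast
    then show ?thesis by (intro exI[of _ 1]) simp
  next
    case True
    have "(X i - X j) \<bullet> (X 1 - X k) \<ge> 0"
      if "i \<in> {1..K}" "j \<in> {1..K}" "k \<in> {1..K}" "i < j" "i < k" for i j k
      using geom[of i j k] mono[of i j] mono[of i k] that by (auto split: if_splits)
    moreover have "(X 1 - X j) \<bullet> (X 1 - X k) > 0" if "j \<in> {2..K}" "k \<in> {2..K}" for j k
      using geom[of 1 j k] mono[of 1 j] mono[of 1 k] that True by auto
    ultimately obtain \<kappa> where \<kappa>: "\<kappa> > 0" and ae: "AE \<omega> in M. (\<lambda>n. policy K X (\<theta> (Suc n) \<omega>) 1) \<longlonglongrightarrow> 1 \<and>
      (\<exists>a>0. \<forall>n. (\<Sum>s<n. policy K X (\<theta> (Suc s) \<omega>) 1 * (1 - policy K X (\<theta> (Suc s) \<omega>) 1))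
         \<le> ln (1 + a * real n) / \<kappa>)"
      using AE_mass_le_ln[OF True \<eta> mono] by blast
    \<comment> \<open>Passing from regret to mass costs \<open>4 * Rmax\<close>, and comparing the
      logarithms costs a factor 2, so \<open>8 * Rmax / \<kappa>\<close> has to equal
      \<open>2 * Rmax / C\<close>.\<close>
    define C where "C = \<kappa> / 4"
    have C: "C > 0" using \<kappa> by (simp add: C_def)
    from ae have "AE \<omega> in M. \<exists>\<tau>\<ge>1. \<forall>T>\<tau>. (\<Sum>s=\<tau>..T. ?reg \<omega> s) \<le> ?b C T"
    proof eventually_elim
      case (elim \<omega>)
      define q where "q = (\<lambda>n. policy K X (\<theta> (Suc n) \<omega>) 1)"
      have lim: "q \<longlonglongrightarrow> 1" using elim unfolding q_def by blast
      obtain a where a: "a > 0" "\<And>n. (\<Sum>s<n. q s * (1 - q s)) \<le> ln (1 + a * real n) / \<kappa>"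
        using elim unfolding q_def by blast
      have q_pos: "0 < q n" for n
        unfolding q_def by (rule policy_pos[OF K_pos])
      have q_le: "q n \<le> 1" for n
        using member_le_sum[of 1 "{1..K}" "policy K X (\<theta> (Suc n) \<omega>)"] K_pos
          policy_sum[OF K_pos, of X "\<theta> (Suc n) \<omega>"] policy_pos[OF K_pos, of X "\<theta> (Suc n) \<omega>"]
        by (simp add: q_def less_imp_le)
      \<comment> \<open>Once \<open>q n > 1 / 2\<close>, the term \<open>1 - q n\<close> is at most
        twice the mass increment \<open>q n * (1 - q n)\<close>.\<close>
      have "eventually (\<lambda>n. q n > 1 / 2) sequentially"
        using lim by (rule order_tendstoD) simp
      then obtain N where N: "\<And>n. n \<ge> N \<Longrightarrow> q n > 1 / 2"
        unfolding eventually_sequentially by blast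
      \<comment> \<open>Beyond \<open>N'\<close> one has \<open>a \<le> C\<^sup>2 * T\<close>, so
        \<open>1 + a * T\<close> is at most the square of \<open>C * T + exp C\<close>. A late start
        thus removes the path-dependent \<open>a\<close> at the price of a factor 2 outside the
        logarithm.\<close>
      obtain N' :: nat where N': "a / C\<^sup>2 \<le> real N'" using real_arch_simple by blast
      define \<tau> where "\<tau> = Suc (max N N')"
      have "(\<Sum>s=\<tau>..T. ?reg \<omega> s) \<le> ?b C T" if T: "T > \<tau>" for T
      proof -
        have "(\<Sum>s=\<tau>..T. ?reg \<omega> s) \<le> 4 * Rmax * (\<Sum>n<T. q n * (1 - q n))"
        proof (rule sum_tail_le_partial)
          show "1 \<le> \<tau>" by (simp add: \<tau>_def)
          show "0 \<le> q n * (1 - q n)" for n using q_pos[of n] q_le[of n] by simp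
          show "0 \<le> 4 * Rmax" using Rmax_pos by simp
          fix n assume "Suc n \<ge> \<tau>"
          then have "q n > 1 / 2" by (intro N) (simp add: \<tau>_def)
          then have "1 * (1 - q n) \<le> 2 * q n * (1 - q n)"
            using q_le[of n] by (intro mult_right_mono) auto
          then have "2 * Rmax * (1 - q n) \<le> 2 * Rmax * (2 * q n * (1 - q n))"
            using Rmax_pos by (intro mult_left_mono) auto
          with suboptimality_le[of "\<theta> (Suc n) \<omega>"]
          show "?reg \<omega> (Suc n) \<le> 4 * Rmax * (q n * (1 - q n))" by (simp add: q_def)
        qed
        also have "\<dots> \<le> 4 * Rmax * (ln (1 + a * real T) / \<kappa>)"
          using a(2)[of T] Rmax_pos by (intro mult_left_mono) auto
        also have "\<dots> \<le> 4 * Rmax * (2 * ln (C * real T + exp C) / \<kappa>)"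
        proof -
          have "a / C\<^sup>2 \<le> real T" using N' T unfolding \<tau>_def by linarith
          then have "a \<le> C\<^sup>2 * real T" using C by (simp add: field_simps)
          then have "a * real T \<le> (C\<^sup>2 * real T) * real T" by (intro mult_right_mono) auto
          moreover have "(C * real T + 1)\<^sup>2 = 1 + C\<^sup>2 * real T * real T + 2 * (C * real T)"
            by (simp add: power2_eq_square algebra_simps)
          moreover have "0 \<le> C * real T" using C by simp
          ultimately have "1 + a * real T \<le> (C * real T + 1)\<^sup>2" by linarith
          also have "\<dots> \<le> (C * real T + exp C)\<^sup>2"
            using C by (intro power_mono) auto
          finally have "ln (1 + a * real T) \<le> ln ((C * real T + exp C)\<^sup>2)"
            using a(1) by (intro ln_mono) (auto intro!: add_pos_nonneg)
          also have "\<dots> = 2 * ln (C * real T + exp C)"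
            using C by (subst ln_realpow) (auto intro!: add_nonneg_pos)
          finally show ?thesis
            using \<kappa> Rmax_pos by (intro mult_left_mono divide_right_mono) auto
        qed
        also have "\<dots> = 2 * Rmax * (1 / C * ln (C * real T + exp C))"
          using \<kappa> by (simp add: C_def)
        \<comment> \<open>Here \<open>K - 1 \<ge> 1\<close>, the logarithm is nonnegative, and so is
          the additional summand.\<close>
        also have "\<dots> \<le> ?b C T"
        proof -
          have "exp C \<ge> 1" using C by simp
          then have ln: "0 \<le> ln (C * real T + exp C)" using C by (intro ln_ge_zero add_increasing) auto
          have "1 / C * ln (C * real T + exp C) \<le> (real K - 1) / C * ln (C * real T + exp C)"
            using True C ln by (intro mult_right_mono divide_right_mono) auto
          moreover have "0 \<le> pi\<^sup>2 * (real K - 1) / (6 * C)" using True C by simp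
          ultimately show ?thesis using Rmax_pos by (intro mult_left_mono) auto
        qed
        finally show ?thesis .
      qed
      moreover have "\<tau> \<ge> 1" by (simp add: \<tau>_def)
      ultimately show ?case by blast
    qed
    with C show ?thesis by blast
  qed
  then obtain C where C: "C > 0" and bound: "AE \<omega> in M. \<exists>\<tau>\<ge>1. \<forall>T>\<tau>. (\<Sum>s=\<tau>..T. ?reg \<omega> s) \<le> ?b C T"
    by blast
  from bound have "AE \<omega> in M. \<exists>\<tau>\<ge>1. \<forall>T>\<tau>.
      (\<Sum>s=\<tau>..T. ?reg \<omega> s) / (real T - real \<tau>) \<le> ?b C T / (real T - real \<tau>)"
  proof eventually_elim
    case (elim \<omega>)
    then obtain \<tau> where \<tau>: "\<tau> \<ge> 1" "\<And>T. T > \<tau> \<Longrightarrow> (\<Sum>s=\<tau>..T. ?reg \<omega> s) \<le> ?b C T" by blast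
    show ?case
    proof (intro exI[of _ \<tau>] conjI allI impI \<tau>(1))
      fix T assume T: "T > \<tau>"
      from \<tau>(2)[OF T] show "(\<Sum>s=\<tau>..T. ?reg \<omega> s) / (real T - real \<tau>) \<le> ?b C T / (real T - real \<tau>)"
        by (rule divide_right_mono) (use T in simp)
    qed
  qed
  with C show ?thesis unfolding a_star by (intro exI[of _ C] conjI)
qed

end
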